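(* Let $\Phi = (A; \{E_i\}_{i=0}^d; A^*; \{E^*_i\}_{i=0}^d)$ be a self-dual Leonard system on $V$ with parameter array $(\{\theta_i\}_{i=0}^d; \{\theta^*_i\}_{i=0}^d; \{\varphi_i\}_{i=1}^d; \{\phi_i\}_{i=1}^d)$. Let $T = \sum_{i=0}^d \eta_{d-i}(A) E^*_0 E_d \tau^*_i(A^* )$. Let $v_0\in E_0V$, $v_d\in E_dV$, $v_0^*\in E_0^*V$, $v_d^*\in E_d^*V$ be nonzero vectors, and set $$\alpha = \frac{\varphi_1 \cdots \varphi_d}{\tau_d(\theta_d)}\frac{(v_0,v^*_0)}{(v^*_0,v^*_0)},\quad \beta = \frac{\varphi_1 \cdots \varphi_d}{\eta_d(\theta_0)}\frac{(v_d,v^*_d)}{(v^*_d,v^*_d)},\quad \alpha^* = \frac{\varphi_1 \cdots \varphi_d}{\tau_d(\theta_d)}\frac{(v_0,v^*_0)}{(v_0,v_0)},\quad \beta^* = \frac{\varphi_1 \cdots \varphi_d}{\eta_d(\theta_0)}\frac{(v_d,v^*_d)}{(v_d,v_d)}.$$ Then for $0\le i\le d$, \begin{align*} T E^*_i v_0 &= \alpha E_i v^*_0, & T \tau^*_i (A^* ) v_0 &= \alpha \tau_i (A) v^*_0, & T \eta^*_i (A^* ) v_0 &= \alpha \eta_i (A) v^*_0,\\ T E^*_i v_d &= \beta E_i v^*_d, & T \tau^*_i (A^* ) v_d &= \beta \tau_i (A) v^*_d, & T \eta^*_i (A^* ) v_d &= \beta \eta_i (A) v^*_d,\\ T E_i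 v^*_0 &= \alpha^* E^*_i v_0, & T \tau_i (A) v^*_0 &= \alpha^* \tau^*_i (A^* ) v_0, & T \eta_i (A) v^*_0 &= \alpha^* \eta^*_i (A^* ) v_0,\\ T E_i v^*_d &= \beta^* E^*_i v_d, & T \tau_i (A) v^*_d &= \beta^* \tau^*_i (A^* ) v_d, & T \eta_i (A) v^*_d &= \beta^* \eta^*_i (A^* ) v_d. \end{align*}
   Context: Let $\mathbb{F}$ be a field and $V$ a vector space over $\mathbb{F}$ with finite positive dimension; $\mathrm{End}(V)$ is the $\mathbb{F}$-algebra of $\mathbb{F}$-linear maps $V\to V$. A square matrix is tridiagonal if each nonzero entry lies on the diagonal, subdiagonal or superdiagonal; a tridiagonal matrix is irreducible if every subdiagonal entry and every superdiagonal entry is nonzero. A Leonard pair on $V$ is an ordered pair $A, A^*$ of elements of $\mathrm{End}(V)$ (the symbol $A^*$ does not denote an adjoint) such that (i) there is a basis of $V$ with respect to which $A$ is represented by an irreducible tridiagonal matrix and $A^*$ by a diagonal matrix; (ii) there is a basis of $V$ with respect to which $A^*$ is represented by an irreducible tridiagonal matrix and $A$ by a diagonal matrix. For a Leonard pair each of $A$, $A^*$ is multiplicity-free (diagonalizable with all eigenspaces of dimension one). For a multiplicity-free element, its primitive idempotents are the projections onto its eigenspaces (identity on one eigenspace, zero on the others). An ordering $\{E_i\}_{i=0}^d$ of the primitive idempotents of $A$ is standard if, for $0\neq w_i\in E_iV$, the matrix representing $A^*$ with respect to the basis $\{w_i\}_{i=0}^d$ is irreducible tridiagonal; a standard ordering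 of the primitive idempotents of $A^*$ is defined similarly with the roles of $A,A^*$ swapped. A Leonard system on $V$ is a sequence $\Phi=(A;\{E_i\}_{i=0}^d;A^*;\{E_i^*\}_{i=0}^d)$ where $A,A^*$ is a Leonard pair on $V$ and $\{E_i\}_{i=0}^d$, $\{E^*_i\}_{i=0}^d$ are standard orderings of the primitive idempotents of $A$, $A^*$ respectively (so $\dim V=d+1$). Let $\theta_i$ (resp. $\theta^*_i$) be the eigenvalue of $A$ (resp. $A^*$) corresponding to $E_i$ (resp. $E_i^*$). $\Phi$ is self-dual if there is an $\mathbb{F}$-algebra automorphism $\sigma$ of $\mathrm{End}(V)$ sending $A\mapsto A^*$, $A^*\mapsto A$, $E_i\mapsto E^*_i$, $E_i^*\mapsto E_i$ $(0\le i\le d)$. For $0\le i\le d$ define polynomials $\tau_i=(x-\theta_0)(x-\theta_1)\cdots(x-\theta_{i-1})$, $\eta_i=(x-\theta_d)(x-\theta_{d-1})\cdots(x-\theta_{d-i+1})$, $\tau_i^*=(x-\theta^*_0)\cdots(x-\theta^*_{i-1})$, $\eta_i^*=(x-\theta^*_d)\cdots(x-\theta^*_{d-i+1})$ (empty products are $1$). Parameter array: for $0\ne v\in E_0^*V$ the vectors $u_i=\tau_i(A)v$ $(0\le i\le d)$ form a basis of $V$, and there are unique nonzero scalars $\{\varphi_i\}_{i=1}^d$ in $\mathbb{F}$ (the first split sequence, independent of $v$) with $A^*u_0=\theta^*_0u_0$ and $A^*u_i=\theta_i^*u_i+\varphi_iu_{i-1}$ $(1\le i\le d)$. Likewise the vectors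 $u'_i=\eta_i(A)v$ form a basis of $V$, and there are unique nonzero scalars $\{\phi_i\}_{i=1}^d$ in $\mathbb{F}$ (the second split sequence) with $A^*u'_0=\theta^*_0u'_0$ and $A^*u'_i=\theta^*_iu'_i+\phi_iu'_{i-1}$ $(1\le i\le d)$. The parameter array of $\Phi$ is $(\{\theta_i\}_{i=0}^d;\{\theta^*_i\}_{i=0}^d;\{\varphi_i\}_{i=1}^d;\{\phi_i\}_{i=1}^d)$. Let $\dagger$ be the unique antiautomorphism of $\mathrm{End}(V)$ fixing each of $A$, $A^*$. Let $(\,,\,)$ be the nonzero bilinear form on $V$ associated with $\dagger$: $(Xu,v)=(u,X^\dagger v)$ for all $u,v\in V$, $X\in\mathrm{End}(V)$; it exists, is unique up to a nonzero scalar multiple, and is nondegenerate and symmetric. It is known that the scalars $(v_0,v_0),(v_d,v_d),(v_0^*,v_0^* ),(v_d^*,v_d^* ),(v_0,v_0^* ),(v_0,v_d^* ),(v_d,v_0^* ),(v_d,v_d^* )$ are all nonzero. *)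

theory Defs
  imports "HOL-Computational_Algebra.Polynomial" "Jordan_Normal_Form.Matrix"
begin

definition irreducible_tridiagonal_mat :: "'a::zero mat \<Rightarrow> bool" where
  "irreducible_tridiagonal_mat B \<longleftrightarrow> square_mat B \<and>
     (\<forall>i < dim_row B. \<forall>j < dim_row B.
        B $$ (i, j) \<noteq> 0 \<longrightarrow> i = j \<or> i = Suc j \<or> j = Suc i) \<and>
     (\<forall>i. Suc i < dim_row B \<longrightarrow> B $$ (Suc i, i) \<noteq> 0 \<and> B $$ (i, Suc i) \<noteq> 0)"

definition tau :: "(nat \<Rightarrow> 'a::field) \<Rightarrow> nat \<Rightarrow> 'a poly" where
  "tau \<theta> i = (\<Prod>j<i. [:- \<theta> j, 1:])"

definition eta :: "nat \<Rightarrow> (nat \<Rightarrow> 'a::field) \<Rightarrow> nat \<Rightarrow> 'a poly" where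
  "eta d \<theta> i = (\<Prod>j<i. [:- \<theta> (d - j), 1:])"

text \<open>The value \<open>p(X)\<close> of a polynomial at an endomorphism of the vector space with scalar
  multiplication \<open>scale\<close>; \<open>X ^^ k\<close> is the \<open>k\<close>-fold composite.\<close>

definition poly_map ::
    "('a::field \<Rightarrow> 'b::ab_group_add \<Rightarrow> 'b) \<Rightarrow>
      'a poly \<Rightarrow> ('b \<Rightarrow> 'b) \<Rightarrow> 'b \<Rightarrow> 'b" where
  "poly_map scale p X v = (\<Sum>k\<le>degree p. scale (coeff p k) ((X ^^ k) v))"

text \<open>The vector space \<open>V\<close> is the whole type \<open>'b\<close>; sequences indexed by \<open>0, \<dots>, d\<close> are functions
  on \<^typ>\<open>nat\<close> of which only the values at \<open>i \<le> d\<close> matter. The qualifier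
  \<open>Modules\<close> distinguishes the linear algebra of HOL from the locale \<open>module\<close> of HOL-Algebra.\<close>

definition endos ::
    "('a::field \<Rightarrow> 'b::ab_group_add \<Rightarrow> 'b) \<Rightarrow>
      ('b \<Rightarrow> 'b) set" where
  "endos scale = {X. Vector_Spaces.linear scale scale X}"

definition basis_seq ::
    "('a::field \<Rightarrow> 'b::ab_group_add \<Rightarrow> 'b) \<Rightarrow>
      nat \<Rightarrow> (nat \<Rightarrow> 'b) \<Rightarrow> bool" where
  "basis_seq scale d u \<longleftrightarrow> inj_on u {..d} \<and> \<not> Modules.module.dependent scale (u ` {..d}) \<and>
     Modules.module.span scale (u ` {..d}) = UNIV"

text \<open>Column \<open>j\<close> holds the coordinates of \<open>X (u j)\<close>.\<close>

definition matrix_of ::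
    "('a::field \<Rightarrow> 'b::ab_group_add \<Rightarrow> 'b) \<Rightarrow>
      nat \<Rightarrow> (nat \<Rightarrow> 'b) \<Rightarrow> ('b \<Rightarrow> 'b) \<Rightarrow> 'a mat" where
  "matrix_of scale d u X =
     mat (d + 1) (d + 1) (\<lambda>(i, j). Modules.module.representation scale (u ` {..d}) (X (u j)) (u i))"

definition leonard_pair ::
    "('a::field \<Rightarrow> 'b::ab_group_add \<Rightarrow> 'b) \<Rightarrow>
      ('b \<Rightarrow> 'b) \<Rightarrow> ('b \<Rightarrow> 'b) \<Rightarrow> bool" where
  "leonard_pair scale A As \<longleftrightarrow> A \<in> endos scale \<and> As \<in> endos scale \<and>
     (\<exists>d u. basis_seq scale d u \<and> irreducible_tridiagonal_mat (matrix_of scale d u A) \<and>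
            diagonal_mat (matrix_of scale d u As)) \<and>
     (\<exists>d u. basis_seq scale d u \<and> irreducible_tridiagonal_mat (matrix_of scale d u As) \<and>
            diagonal_mat (matrix_of scale d u A))"

definition eigenspace ::
    "('a::field \<Rightarrow> 'b::ab_group_add \<Rightarrow> 'b) \<Rightarrow>
      ('b \<Rightarrow> 'b) \<Rightarrow> 'a \<Rightarrow> 'b set" where
  "eigenspace scale X \<theta> = {v. X v = scale \<theta> v}"

text \<open>\<open>E\<close> is the primitive idempotent of \<open>X\<close> for the eigenvalue \<open>\<theta>\<close>. The conditions determine
  \<open>E\<close> only when \<open>X\<close> is diagonalizable; below, \<open>X\<close> is always a member of a Leonard pair and
  hence multiplicity-free.\<close>

definition primitive_idempotent_for ::
    "('a::field \<Rightarrow> 'b::ab_group_add \<Rightarrow> 'b) \<Rightarrow>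
      ('b \<Rightarrow> 'b) \<Rightarrow> 'a \<Rightarrow> ('b \<Rightarrow> 'b) \<Rightarrow> bool" where
  "primitive_idempotent_for scale X \<theta> E \<longleftrightarrow> eigenspace scale X \<theta> \<noteq> {0} \<and> E \<in> endos scale \<and>
     (\<forall>v \<in> eigenspace scale X \<theta>. E v = v) \<and>
     (\<forall>\<mu>. \<mu> \<noteq> \<theta> \<longrightarrow> (\<forall>v \<in> eigenspace scale X \<mu>. E v = 0))"

definition primitive_idempotents ::
    "('a::field \<Rightarrow> 'b::ab_group_add \<Rightarrow> 'b) \<Rightarrow>
      ('b \<Rightarrow> 'b) \<Rightarrow> ('b \<Rightarrow> 'b) set" where
  "primitive_idempotents scale X = {E. \<exists>\<theta>. primitive_idempotent_for scale X \<theta> E}"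

definition standard_ordering ::
    "('a::field \<Rightarrow> 'b::ab_group_add \<Rightarrow> 'b) \<Rightarrow>
      nat \<Rightarrow> ('b \<Rightarrow> 'b) \<Rightarrow> ('b \<Rightarrow> 'b) \<Rightarrow> (nat \<Rightarrow> 'b \<Rightarrow> 'b) \<Rightarrow> bool" where
  "standard_ordering scale d A As E \<longleftrightarrow>
     bij_betw E {..d} (primitive_idempotents scale A) \<and>
     (\<forall>w. (\<forall>i\<le>d. w i \<in> range (E i) \<and> w i \<noteq> 0) \<longrightarrow>
        basis_seq scale d w \<and> irreducible_tridiagonal_mat (matrix_of scale d w As))"

definition leonard_system ::
    "('a::field \<Rightarrow> 'b::ab_group_add \<Rightarrow> 'b) \<Rightarrow>
      nat \<Rightarrow> ('b \<Rightarrow> 'b) \<Rightarrow> (nat \<Rightarrow> 'b \<Rightarrow> 'b) \<Rightarrow> ('b \<Rightarrow> 'b) \<Rightarrow> (nat \<Rightarrow> 'b \<Rightarrow> 'b) \<Rightarrow> bool" where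
  "leonard_system scale d A E As Es \<longleftrightarrow> leonard_pair scale A As \<and>
     standard_ordering scale d A As E \<and> standard_ordering scale d As A Es"

definition linear_bijection ::
    "('a::field \<Rightarrow> 'b::ab_group_add \<Rightarrow> 'b) \<Rightarrow>
      (('b \<Rightarrow> 'b) \<Rightarrow> ('b \<Rightarrow> 'b)) \<Rightarrow> bool" where
  "linear_bijection scale \<sigma> \<longleftrightarrow> bij_betw \<sigma> (endos scale) (endos scale) \<and>
     (\<forall>X \<in> endos scale. \<forall>Y \<in> endos scale. \<sigma> (\<lambda>v. X v + Y v) = (\<lambda>v. \<sigma> X v + \<sigma> Y v)) \<and>
     (\<forall>c. \<forall>X \<in> endos scale. \<sigma> (\<lambda>v. scale c (X v)) = (\<lambda>v. scale c (\<sigma> X v)))"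

definition algebra_automorphism ::
    "('a::field \<Rightarrow> 'b::ab_group_add \<Rightarrow> 'b) \<Rightarrow>
      (('b \<Rightarrow> 'b) \<Rightarrow> ('b \<Rightarrow> 'b)) \<Rightarrow> bool" where
  "algebra_automorphism scale \<sigma> \<longleftrightarrow> linear_bijection scale \<sigma> \<and> \<sigma> id = id \<and>
     (\<forall>X \<in> endos scale. \<forall>Y \<in> endos scale. \<sigma> (X \<circ> Y) = \<sigma> X \<circ> \<sigma> Y)"

definition algebra_antiautomorphism ::
    "('a::field \<Rightarrow> 'b::ab_group_add \<Rightarrow> 'b) \<Rightarrow>
      (('b \<Rightarrow> 'b) \<Rightarrow> ('b \<Rightarrow> 'b)) \<Rightarrow> bool" where
  "algebra_antiautomorphism scale \<sigma> \<longleftrightarrow> linear_bijection scale \<sigma> \<and> \<sigma> id = id \<and>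
     (\<forall>X \<in> endos scale. \<forall>Y \<in> endos scale. \<sigma> (X \<circ> Y) = \<sigma> Y \<circ> \<sigma> X)"

definition self_dual ::
    "('a::field \<Rightarrow> 'b::ab_group_add \<Rightarrow> 'b) \<Rightarrow>
      nat \<Rightarrow> ('b \<Rightarrow> 'b) \<Rightarrow> (nat \<Rightarrow> 'b \<Rightarrow> 'b) \<Rightarrow> ('b \<Rightarrow> 'b) \<Rightarrow> (nat \<Rightarrow> 'b \<Rightarrow> 'b) \<Rightarrow> bool" where
  "self_dual scale d A E As Es \<longleftrightarrow> (\<exists>\<sigma>. algebra_automorphism scale \<sigma> \<and> \<sigma> A = As \<and> \<sigma> As = A \<and>
     (\<forall>i\<le>d. \<sigma> (E i) = Es i \<and> \<sigma> (Es i) = E i))"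

text \<open>\<open>c\<^sub>1, \<dots>, c\<^sub>d\<close> are the nonzero scalars for which \<open>As\<close> acts on \<open>p\<^sub>0(A)v, \<dots>, p\<^sub>d(A)v\<close>
  by the split relations, for every nonzero \<open>v \<in> E\<^sub>0\<^sup>*V\<close>: the first split sequence for
  \<open>p = \<tau>\<close>, the second for \<open>p = \<eta>\<close>.\<close>

definition split_sequence ::
    "('a::field \<Rightarrow> 'b::ab_group_add \<Rightarrow> 'b) \<Rightarrow>
      nat \<Rightarrow> ('b \<Rightarrow> 'b) \<Rightarrow> ('b \<Rightarrow> 'b) \<Rightarrow> ('b \<Rightarrow> 'b) \<Rightarrow> (nat \<Rightarrow> 'a) \<Rightarrow> (nat \<Rightarrow> 'a poly)
      \<Rightarrow> (nat \<Rightarrow> 'a) \<Rightarrow> bool" where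
  "split_sequence scale d A As Es0 \<theta>s p c \<longleftrightarrow> (\<forall>i \<in> {1..d}. c i \<noteq> 0) \<and>
     (\<forall>v \<in> range Es0. v \<noteq> 0 \<longrightarrow>
        As (poly_map scale (p 0) A v) = scale (\<theta>s 0) (poly_map scale (p 0) A v) \<and>
        (\<forall>i \<in> {1..d}. As (poly_map scale (p i) A v) =
           scale (\<theta>s i) (poly_map scale (p i) A v) + scale (c i) (poly_map scale (p (i - 1)) A v)))"

definition parameter_array ::
    "('a::field \<Rightarrow> 'b::ab_group_add \<Rightarrow> 'b) \<Rightarrow>
      nat \<Rightarrow> ('b \<Rightarrow> 'b) \<Rightarrow> (nat \<Rightarrow> 'b \<Rightarrow> 'b) \<Rightarrow> ('b \<Rightarrow> 'b) \<Rightarrow> (nat \<Rightarrow> 'b \<Rightarrow> 'b)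
      \<Rightarrow> (nat \<Rightarrow> 'a) \<Rightarrow> (nat \<Rightarrow> 'a) \<Rightarrow> (nat \<Rightarrow> 'a) \<Rightarrow> (nat \<Rightarrow> 'a) \<Rightarrow> bool" where
  "parameter_array scale d A E As Es \<theta> \<theta>s varphi phi \<longleftrightarrow>
     (\<forall>i\<le>d. primitive_idempotent_for scale A (\<theta> i) (E i)) \<and>
     (\<forall>i\<le>d. primitive_idempotent_for scale As (\<theta>s i) (Es i)) \<and>
     split_sequence scale d A As (Es 0) \<theta>s (tau \<theta>) varphi \<and>
     split_sequence scale d A As (Es 0) \<theta>s (eta d \<theta>) phi"

definition bilinear_form ::
    "('a::field \<Rightarrow> 'b::ab_group_add \<Rightarrow> 'b) \<Rightarrow>
      ('b \<Rightarrow> 'b \<Rightarrow> 'a) \<Rightarrow> bool" where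
  "bilinear_form scale B \<longleftrightarrow> (\<forall>v. Vector_Spaces.linear scale (*) (\<lambda>u. B u v)) \<and>
     (\<forall>u. Vector_Spaces.linear scale (*) (B u))"

text \<open>The nonzero bilinear form associated with an antiautomorphism \<open>\<dagger>\<close>, which is unique
  up to a nonzero scalar.\<close>

definition associated_form ::
    "('a::field \<Rightarrow> 'b::ab_group_add \<Rightarrow> 'b) \<Rightarrow>
      (('b \<Rightarrow> 'b) \<Rightarrow> ('b \<Rightarrow> 'b)) \<Rightarrow> ('b \<Rightarrow> 'b \<Rightarrow> 'a) \<Rightarrow> bool" where
  "associated_form scale dag B \<longleftrightarrow> bilinear_form scale B \<and> (\<exists>u v. B u v \<noteq> 0) \<and>
     (\<forall>X \<in> endos scale. \<forall>u v. B (X u) v = B u (dag X v))"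

end

theory Submission imports Defs begin

text \<open>
  The heart of the matter is that \<open>T\<close> intertwines \<open>A\<close> and \<open>A\<^sup>*\<close> in both directions:
  \<open>T A = A\<^sup>* T\<close> and \<open>T A\<^sup>* = A T\<close>. Self-duality makes the two eigenvalue sequences equal, so it
  follows that \<open>T p(A) = p(A\<^sup>*) T\<close> and \<open>T p(A\<^sup>*) = p(A) T\<close> for every polynomial \<open>p\<close>, as well as
  \<open>T E\<^sub>i = E\<^sub>i\<^sup>* T\<close> and \<open>T E\<^sub>i\<^sup>* = E\<^sub>i T\<close>. All twelve formulas then follow from the four values
  \<open>T v\<^sub>0 = \<alpha> v\<^sub>0\<^sup>*\<close>, \<open>T v\<^sub>d = \<beta> v\<^sub>d\<^sup>*\<close>, \<open>T v\<^sub>0\<^sup>* = \<alpha>\<^sup>* v\<^sub>0\<close> and \<open>T v\<^sub>d\<^sup>* = \<beta>\<^sup>* v\<^sub>d\<close>.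

  To see how \<open>T\<close> acts, take the basis \<open>u\<^sub>i = \<eta>\<^sub>i(A) v\<^sub>0\<^sup>*\<close>. On it \<open>A\<close> is lower bidiagonal with
  diagonal \<open>\<theta>\<^sub>d, \<dots>, \<theta>\<^sub>0\<close> and subdiagonal entries \<open>1\<close>, and \<open>A\<^sup>*\<close> is upper bidiagonal with
  diagonal \<open>\<theta>\<^sub>0, \<dots>, \<theta>\<^sub>d\<close> and superdiagonal entries \<open>\<phi>\<^sub>i\<close>. The maps \<open>E\<^sub>d \<tau>\<^sub>i(A\<^sup>*)\<close> are, up to
  scalars, the functionals dual to this basis (\<open>E_d_tau_u\<close>), which gives
  \<open>T u\<^sub>j = C \<phi>\<^sub>1 \<cdots> \<phi>\<^sub>j u\<^sub>d\<^sub>-\<^sub>j\<close> with \<open>E\<^sub>0\<^sup>* E\<^sub>d v\<^sub>0\<^sup>* = C v\<^sub>0\<^sup>*\<close> (\<open>T_u\<close>). Reversing the basis in this way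
  interchanges the two bidiagonal shapes, and the intertwining relations (\<open>T_As\<close>, \<open>T_A\<close>) become
  the symmetry \<open>\<phi>\<^sub>i = \<phi>\<^sub>d\<^sub>-\<^sub>i\<^sub>+\<^sub>1\<close> (\<open>phi_symmetric\<close>). The symmetry holds since the chain
  \<open>\<eta>\<^sub>i(A\<^sup>*) u\<^sub>d\<close>, which descends the same basis from its last member \<open>u\<^sub>d \<in> E\<^sub>0V\<close>, is the analogue
  of the chain \<open>u\<^sub>i\<close> for the dual system, which self-duality identifies with the given one.

  The scalars are found in two steps. Computing the \<open>E\<^sub>0\<^sup>*\<close>-component of \<open>\<tau>\<^sub>d(A) v\<^sub>0\<^sup>*\<close> in two ways
  gives \<open>C \<tau>\<^sub>d(\<theta>\<^sub>d) \<eta>\<^sub>d(\<theta>\<^sub>0) = \<phi>'\<^sub>1 \<cdots> \<phi>'\<^sub>d\<close>, where \<open>\<phi>'\<close> is the first split sequence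
  (\<open>C_product\<close>). Hence on \<open>E\<^sub>0V\<close>, \<open>E\<^sub>dV\<close>, \<open>E\<^sub>0\<^sup>*V\<close> and \<open>E\<^sub>d\<^sup>*V\<close> the map \<open>T\<close> is a known multiple of
  \<open>E\<^sub>0\<^sup>*\<close>, \<open>E\<^sub>d\<^sup>*\<close>, \<open>E\<^sub>0\<close> and \<open>E\<^sub>d\<close> respectively (\<open>T_E_0\<close>, \<open>T_E_d\<close>, \<open>T_Es_0\<close>, \<open>T_Es_d\<close>). Finally, \<open>A\<close> and \<open>A\<^sup>*\<close>
  are self-adjoint for the form, so a projection onto an eigenline is given by quotients of
  values of the form (\<open>projection_by_form\<close>).
\<close>

section \<open>Polynomials of a linear map\<close>

context vector_space
begin

lemma poly_map_eq_sum:
  assumes "degree p \<le> n"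
  shows "poly_map scale p X v = (\<Sum>k\<le>n. coeff p k *s (X ^^ k) v)"
  unfolding poly_map_def
  by (rule sum.mono_neutral_left) (use assms in \<open>auto simp: coeff_eq_0\<close>)

lemma poly_map_0 [simp]: "poly_map scale 0 X v = 0"
  by (simp add: poly_map_def)

lemma poly_map_pCons:
  assumes "Vector_Spaces.linear scale scale X"
  shows "poly_map scale (pCons a p) X v = a *s v + X (poly_map scale p X v)"
proof -
  interpret X: Vector_Spaces.linear scale scale X by fact
  have "poly_map scale (pCons a p) X v
      = (\<Sum>k\<le>Suc (degree p). coeff (pCons a p) k *s (X ^^ k) v)"
    by (rule poly_map_eq_sum) (rule degree_pCons_le)
  also have "\<dots> = a *s v + (\<Sum>k\<le>degree p. coeff p k *s (X ^^ Suc k) v)"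
    by (subst sum.atMost_Suc_shift) simp
  also have "(\<Sum>k\<le>degree p. coeff p k *s (X ^^ Suc k) v) = X (poly_map scale p X v)"
    by (simp add: poly_map_def X.sum X.scale)
  finally show ?thesis .
qed

lemma poly_map_1 [simp]: "poly_map scale 1 X v = v"
  by (simp add: poly_map_def)

lemma poly_map_add:
  "poly_map scale (p + q) X v = poly_map scale p X v + poly_map scale q X v"
proof -
  let ?n = "max (degree p) (degree q)"
  have "degree (p + q) \<le> ?n" by (rule degree_add_le_max)
  then show ?thesis
    by (simp add: poly_map_eq_sum[of _ ?n] scale_left_distrib sum.distrib)
qed

lemma poly_map_smult:
  "poly_map scale (Polynomial.smult c p) X v = c *s poly_map scale p X v"
  by (simp add: poly_map_eq_sum[of _ "degree p"] degree_smult_le scale_sum_right)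

lemma poly_map_times_root:
  assumes "Vector_Spaces.linear scale scale X"
  shows "poly_map scale (p * [:- a, 1:]) X v = X (poly_map scale p X v) - a *s poly_map scale p X v"
proof -
  have "p * [:- a, 1:] = Polynomial.smult (- a) p + pCons 0 p"
    by (simp add: mult.commute[of p])
  then have "poly_map scale (p * [:- a, 1:]) X v
      = poly_map scale (Polynomial.smult (- a) p) X v + poly_map scale (pCons 0 p) X v"
    by (simp only: poly_map_add)
  then show ?thesis
    by (simp only: poly_map_smult poly_map_pCons[OF assms]) simp
qed

lemma linear_poly_map:
  assumes "Vector_Spaces.linear scale scale X"
  shows "Vector_Spaces.linear scale scale (poly_map scale p X)"
proof -
  interpret X: Vector_Spaces.linear scale scale X by fact
  have "poly_map scale p X (x + y) = poly_map scale p X x + poly_map scale p X y" for x y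
    by (induction p)
      (simp_all add: poly_map_pCons[OF assms] X.add scale_right_distrib algebra_simps)
  moreover have "poly_map scale p X (c *s x) = c *s poly_map scale p X x" for c x
    by (induction p)
      (simp_all add: poly_map_pCons[OF assms] X.scale scale_right_distrib mult.commute)
  ultimately show ?thesis
    unfolding Vector_Spaces.linear_iff using vector_space_axioms by blast
qed

lemma poly_map_at_0:
  assumes "Vector_Spaces.linear scale scale X"
  shows "poly_map scale p X 0 = 0"
  by (rule module_hom.zero[OF module_hom_linearI[OF linear_poly_map[OF assms]]])

lemma poly_map_intertwine:
  assumes "Vector_Spaces.linear scale scale X" "Vector_Spaces.linear scale scale Y" "Vector_Spaces.linear scale scale T"
    and "\<And>w. T (X w) = Y (T w)"
  shows "T (poly_map scale p X v) = poly_map scale p Y (T v)"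
proof -
  interpret T: Vector_Spaces.linear scale scale T by fact
  show ?thesis
    by (induction p) (simp_all add: poly_map_pCons assms(1,2) T.add T.scale assms(4))
qed

lemma poly_map_commute:
  assumes "Vector_Spaces.linear scale scale X"
  shows "poly_map scale p X (X v) = X (poly_map scale p X v)"
  by (rule poly_map_intertwine[symmetric, OF assms assms assms]) simp

end

lemma tau_0 [simp]: "tau \<theta> 0 = 1"
  and tau_Suc: "tau \<theta> (Suc i) = tau \<theta> i * [:- \<theta> i, 1:]"
  by (simp_all add: tau_def)

lemma eta_0 [simp]: "eta d \<theta> 0 = 1"
  and eta_Suc: "eta d \<theta> (Suc i) = eta d \<theta> i * [:- \<theta> (d - i), 1:]"
  by (simp_all add: eta_def)

lemma poly_tau: "poly (tau \<theta> i) x = (\<Prod>j<i. x - \<theta> j)"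
  by (simp add: tau_def poly_prod)

lemma poly_eta: "poly (eta d \<theta> i) x = (\<Prod>j<i. x - \<theta> (d - j))"
  by (simp add: eta_def poly_prod)

section \<open>Resolutions of the identity into lines of eigenvectors\<close>

text \<open>This locale records all that multiplicity-freeness contributes: \<open>V\<close> is a direct sum of \<open>d + 1\<close>
  lines, \<open>E i\<close> projects onto the \<open>i\<close>-th one, and \<open>X\<close> acts there by the scalar \<open>\<theta> i\<close>, with
  distinct scalars on distinct lines. Equations between vectors can then be checked
  componentwise, where polynomials in \<open>X\<close> become scalars.\<close>

locale eigenline_resolution = vector_space scale
  for scale :: "'a::field \<Rightarrow> 'b::ab_group_add \<Rightarrow> 'b" (infixr \<open>*s\<close> 75) +
  fixes d :: nat and X :: "'b \<Rightarrow> 'b" and E :: "nat \<Rightarrow> 'b \<Rightarrow> 'b" and \<theta> :: "nat \<Rightarrow> 'a"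
  assumes linear_X: "Vector_Spaces.linear scale scale X"
    and linear_E: "i \<le> d \<Longrightarrow> Vector_Spaces.linear scale scale (E i)"
    and X_E: "i \<le> d \<Longrightarrow> X (E i v) = \<theta> i *s E i v"
    and E_E: "i \<le> d \<Longrightarrow> j \<le> d \<Longrightarrow> E i (E j v) = (if i = j then E i v else 0)"
    and sum_E: "(\<Sum>i\<le>d. E i v) = v"
    and inj_\<theta>: "inj_on \<theta> {..d}"
    and line_E: "i \<le> d \<Longrightarrow> E i x \<noteq> 0 \<Longrightarrow> \<exists>c. E i y = c *s E i x"
begin

lemma E_same [simp]: "i \<le> d \<Longrightarrow> E i (E i v) = E i v"
  by (simp add: E_E)

lemma E_zero [simp]: "i \<le> d \<Longrightarrow> E i 0 = 0"
  by (rule module_hom.zero[OF module_hom_linearI[OF linear_E]])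

lemma E_add: "i \<le> d \<Longrightarrow> E i (x + y) = E i x + E i y"
  using linear_E by (simp add: Vector_Spaces.linear_iff)

lemma E_scale: "i \<le> d \<Longrightarrow> E i (c *s x) = c *s E i x"
  using linear_E by (simp add: Vector_Spaces.linear_iff)

lemma E_diff: "i \<le> d \<Longrightarrow> E i (x - y) = E i x - E i y"
  by (rule module_hom.diff[OF module_hom_linearI[OF linear_E]])

lemma E_sum: "i \<le> d \<Longrightarrow> E i (sum f S) = (\<Sum>s\<in>S. E i (f s))"
  by (rule module_hom.sum[OF module_hom_linearI[OF linear_E]])

lemma eq_if_components_eq:
  assumes "\<And>i. i \<le> d \<Longrightarrow> E i x = E i y"
  shows "x = y"
  using sum_E[of x] sum_E[of y] assms by (metis (no_types, lifting) atMost_iff sum.cong)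

lemma E_X:
  assumes "i \<le> d"
  shows "E i (X v) = \<theta> i *s E i v"
proof -
  interpret X: Vector_Spaces.linear scale scale X by (rule linear_X)
  have "X v = (\<Sum>j\<le>d. X (E j v))"
    using X.sum[of "\<lambda>j. E j v" "{..d}"] by (simp add: sum_E)
  also have "\<dots> = (\<Sum>j\<le>d. \<theta> j *s E j v)"
    by (simp add: X_E)
  finally have "E i (X v) = (\<Sum>j\<le>d. \<theta> j *s (if i = j then E i v else 0))"
    using assms by (simp add: E_sum E_scale E_E)
  also have "\<dots> = (\<Sum>j\<le>d. if i = j then \<theta> i *s E i v else 0)"
    by (rule sum.cong) auto
  also have "\<dots> = \<theta> i *s E i v"
    using assms by simp
  finally show ?thesis .
qed

lemma eigenvectorD:
  assumes "X v = \<theta> i *s v" "i \<le> d" "j \<le> d" "j \<noteq> i"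
  shows "E j v = 0"
proof -
  have "\<theta> j *s E j v = \<theta> i *s E j v"
    by (metis E_X E_scale assms(1,3))
  moreover have "\<theta> j \<noteq> \<theta> i"
    using inj_onD[OF inj_\<theta>, of j i] assms by auto
  ultimately show ?thesis by auto
qed

lemma fixed_if_components_vanish:
  assumes "i \<le> d" "\<And>j. j \<le> d \<Longrightarrow> j \<noteq> i \<Longrightarrow> E j v = 0"
  shows "E i v = v"
  by (rule eq_if_components_eq) (use assms in \<open>auto simp: E_E\<close>)

lemma eigenvector_fixed:
  assumes "X v = \<theta> i *s v" "i \<le> d"
  shows "E i v = v"
  using fixed_if_components_vanish eigenvectorD assms by blast

lemma E_poly_map:
  assumes "i \<le> d"
  shows "E i (poly_map scale p X v) = poly p (\<theta> i) *s E i v"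
proof (induction p)
  case 0
  then show ?case using assms by simp
next
  case (pCons a p)
  then show ?case
    using assms
    by (simp add: poly_map_pCons linear_X E_add E_scale E_X scale_left_distrib)
qed

lemma line_multiple:
  assumes "i \<le> d" "x = E i x" "x \<noteq> 0" "y = E i y"
  obtains c where "y = c *s x"
  using line_E[of i x y] assms by metis

end

text \<open>A linear map that intertwines \<open>X\<close> and \<open>Y\<close>, two maps with the same eigenvalues, carries each
  eigenline of \<open>X\<close> into that of \<open>Y\<close>, so it intertwines the projections.\<close>

lemma intertwine_idempotents:
  assumes "eigenline_resolution scale d X E \<theta>" "eigenline_resolution scale d Y F \<theta>"
    and "Vector_Spaces.linear scale scale T" "\<And>w. T (X w) = Y (T w)" "i \<le> d"
  shows "T (E i v) = F i (T v)"
proof -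
  interpret X: eigenline_resolution scale d X E \<theta> by fact
  interpret Y: eigenline_resolution scale d Y F \<theta> by fact
  interpret T: Vector_Spaces.linear scale scale T by fact
  have Y_T: "Y (T (E j v)) = scale (\<theta> j) (T (E j v))" if "j \<le> d" for j
    using that assms(4) by (metis X.X_E T.scale)
  have "F i (T v) = (\<Sum>j\<le>d. F i (T (E j v)))"
    using X.sum_E[of v] T.sum[of "\<lambda>j. E j v" "{..d}"] Y.E_sum[OF \<open>i \<le> d\<close>, of "\<lambda>j. T (E j v)"]
    by metis
  also have "\<dots> = (\<Sum>j\<le>d. if i = j then T (E i v) else 0)"
    using Y.eigenvector_fixed[OF Y_T] Y.eigenvectorD[OF Y_T _ \<open>i \<le> d\<close>]
    by (intro sum.cong) auto
  finally show ?thesis using \<open>i \<le> d\<close> by simp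
qed

section \<open>The resolutions attached to a Leonard system\<close>

context vector_space
begin

lemma basis_seq_expansion:
  assumes "basis_seq scale d u"
  shows "(\<Sum>i\<le>d. representation (u ` {..d}) x (u i) *s u i) = x"
proof -
  have "(\<Sum>b\<in>u ` {..d}. representation (u ` {..d}) x b *s b) = x"
    using assms by (intro sum_representation_eq) (auto simp: basis_seq_def)
  then show ?thesis
    using assms by (simp add: basis_seq_def sum.reindex)
qed

lemma matrix_of_column:
  assumes "basis_seq scale d u" "j \<le> d"
  shows "X (u j) = (\<Sum>i\<le>d. matrix_of scale d u X $$ (i, j) *s u i)"
proof -
  have "X (u j) = (\<Sum>i\<le>d. representation (u ` {..d}) (X (u j)) (u i) *s u i)"
    by (rule basis_seq_expansion[OF assms(1), symmetric])
  also have "\<dots> = (\<Sum>i\<le>d. matrix_of scale d u X $$ (i, j) *s u i)"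
    using assms(2) by (intro sum.cong) (auto simp: matrix_of_def)
  finally show ?thesis .
qed

lemma diagonal_matrix_of_eigenvector:
  assumes "basis_seq scale d u" "diagonal_mat (matrix_of scale d u X)" "j \<le> d"
  shows "X (u j) = matrix_of scale d u X $$ (j, j) *s u j"
proof -
  have "X (u j) = (\<Sum>i\<le>d. matrix_of scale d u X $$ (i, j) *s u i)"
    by (rule matrix_of_column) (use assms in auto)
  also have "\<dots> = (\<Sum>i\<le>d. if i = j then matrix_of scale d u X $$ (j, j) *s u j else 0)"
    using assms(2,3) by (intro sum.cong) (auto simp: diagonal_mat_def matrix_of_def)
  finally show ?thesis using assms(3) by simp
qed

lemma linear_eq_on_basis_seq:
  assumes "basis_seq scale d u" "Vector_Spaces.linear scale scale F" "Vector_Spaces.linear scale scale G"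
    and "\<And>j. j \<le> d \<Longrightarrow> F (u j) = G (u j)"
  shows "F x = G x"
proof -
  interpret vector_space_pair scale scale
    by (intro vector_space_pair.intro vector_space_axioms)
  show ?thesis
    by (rule linear_eq_on[OF assms(2,3), of _ "u ` {..d}"]) (use assms in \<open>auto simp: basis_seq_def\<close>)
qed

lemma primitive_idempotent_on_eigenvector:
  assumes "primitive_idempotent_for scale X \<theta> P" "X v = c *s v"
  shows "P v = (if c = \<theta> then v else 0)"
  using assms by (auto simp: primitive_idempotent_for_def eigenspace_def)

text \<open>A primitive idempotent is determined by its eigenvalue only because \<open>X\<close> is
  diagonalizable: on an eigenbasis of \<open>X\<close> its values are prescribed.\<close>

lemma primitive_idempotent_unique:
  assumes "basis_seq scale n u" "diagonal_mat (matrix_of scale n u X)"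
    and P: "primitive_idempotent_for scale X \<theta> P"
    and Q: "primitive_idempotent_for scale X \<theta> Q"
  shows "P = Q"
proof
  fix x
  show "P x = Q x"
  proof (rule linear_eq_on_basis_seq[OF assms(1), where F = P and G = Q])
    show "Vector_Spaces.linear scale scale P" "Vector_Spaces.linear scale scale Q"
      using P Q by (auto simp: primitive_idempotent_for_def endos_def)
    fix j assume "j \<le> n"
    note eig = diagonal_matrix_of_eigenvector[OF assms(1,2) this]
    show "P (u j) = Q (u j)"
      using primitive_idempotent_on_eigenvector[OF P eig]
        primitive_idempotent_on_eigenvector[OF Q eig] by simp
  qed
qed

lemma primitive_idempotent_range:
  assumes "basis_seq scale n u" "diagonal_mat (matrix_of scale n u X)"
    and lin: "Vector_Spaces.linear scale scale X"
    and P: "primitive_idempotent_for scale X \<theta> P"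
  shows "X (P x) = \<theta> *s P x"
proof -
  have P_lin: "Vector_Spaces.linear scale scale P"
    using P by (auto simp: primitive_idempotent_for_def endos_def)
  have "(X \<circ> P) x = ((\<lambda>v. \<theta> *s v) \<circ> P) x"
  proof (rule linear_eq_on_basis_seq[OF assms(1), where F = "X \<circ> P" and G = "(\<lambda>v. \<theta> *s v) \<circ> P"])
    show "Vector_Spaces.linear scale scale (X \<circ> P)"
      by (rule Vector_Spaces.linear_compose[OF P_lin lin])
    show "Vector_Spaces.linear scale scale ((\<lambda>v. \<theta> *s v) \<circ> P)"
      by (rule Vector_Spaces.linear_compose[OF P_lin linear_scale_self])
    fix j assume "j \<le> n"
    note eig = diagonal_matrix_of_eigenvector[OF assms(1,2) this]
    interpret X: Vector_Spaces.linear scale scale X by (rule lin)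
    show "(X \<circ> P) (u j) = ((\<lambda>v. \<theta> *s v) \<circ> P) (u j)"
      using primitive_idempotent_on_eigenvector[OF P eig] eig by auto
  qed
  then show ?thesis by simp
qed

lemma standard_ordering_range_nontrivial:
  assumes "Vector_Spaces.linear scale scale X" "standard_ordering scale d X Y E" "i \<le> d"
  shows "\<exists>w. w \<in> range (E i) \<and> w \<noteq> 0"
proof -
  obtain \<mu> where P: "primitive_idempotent_for scale X \<mu> (E i)"
    using assms by (force simp: standard_ordering_def bij_betw_def primitive_idempotents_def)
  interpret X: Vector_Spaces.linear scale scale X by (rule assms(1))
  have "0 \<in> eigenspace scale X \<mu>" by (simp add: eigenspace_def)
  then obtain w where "w \<in> eigenspace scale X \<mu>" "w \<noteq> 0"
    using P unfolding primitive_idempotent_for_def by blast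
  moreover from this have "E i w = w"
    using P by (auto simp: primitive_idempotent_for_def)
  ultimately show ?thesis by (metis rangeI)
qed

text \<open>The \<open>d + 1\<close> distinct idempotents of a standard ordering have distinct eigenvalues, and
  vectors chosen from their ranges form a basis, so the ranges are lines with sum \<open>V\<close>.\<close>

lemma standard_ordering_eigenline_resolution:
  assumes diag: "basis_seq scale n u" "diagonal_mat (matrix_of scale n u X)"
    and lin: "Vector_Spaces.linear scale scale X"
    and ord: "standard_ordering scale d X Y E"
    and P: "\<And>i. i \<le> d \<Longrightarrow> primitive_idempotent_for scale X (\<theta> i) (E i)"
  shows "eigenline_resolution scale d X E \<theta>"
proof -
  have E_lin: "Vector_Spaces.linear scale scale (E i)" if "i \<le> d" for i
    using P[OF that] by (auto simp: primitive_idempotent_for_def endos_def)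
  have inj: "inj_on \<theta> {..d}"
  proof (rule inj_onI)
    fix i j assume ij: "i \<in> {..d}" "j \<in> {..d}" "\<theta> i = \<theta> j"
    then have "E i = E j"
      using primitive_idempotent_unique[OF diag P[of i]] P[of j] by simp
    then show "i = j"
      using ord ij by (auto simp: standard_ordering_def bij_betw_def dest: inj_onD)
  qed
  have XE: "X (E i v) = \<theta> i *s E i v" if "i \<le> d" for i v
    by (rule primitive_idempotent_range[OF diag lin P[OF that]])
  have EE: "E i (E j v) = (if i = j then E i v else 0)" if "i \<le> d" "j \<le> d" for i j v
    using primitive_idempotent_on_eigenvector[OF P[OF that(1)] XE[OF that(2)]]
      inj_onD[OF inj, of i j] that by auto
  have "\<exists>w. w \<in> range (E i) \<and> w \<noteq> 0" if "i \<le> d" for i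
    by (rule standard_ordering_range_nontrivial[OF lin ord that])
  then obtain w where w: "\<And>i. i \<le> d \<Longrightarrow> w i \<in> range (E i) \<and> w i \<noteq> 0"
    by metis
  have basis: "basis_seq scale d w"
    using ord w by (simp add: standard_ordering_def)
  have Ew: "E i (w j) = (if i = j then w i else 0)" if "i \<le> d" "j \<le> d" for i j
  proof -
    obtain y where "w j = E j y" using w[OF \<open>j \<le> d\<close>] by auto
    then show ?thesis using EE[OF that] by auto
  qed
  have sum: "(\<Sum>i\<le>d. E i v) = v" for v
  proof -
    have "(\<Sum>i\<le>d. E i v) = id v"
    proof (rule linear_eq_on_basis_seq[OF basis, where F = "\<lambda>v. \<Sum>i\<le>d. E i v" and G = id])
      show "Vector_Spaces.linear scale scale (\<lambda>v. \<Sum>i\<le>d. E i v)"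
        using E_lin by (simp add: Vector_Spaces.linear_iff sum.distrib scale_sum_right vector_space_axioms)
      show "Vector_Spaces.linear scale scale id" by (rule linear_id)
      fix j assume "j \<le> d"
      then show "(\<Sum>i\<le>d. E i (w j)) = id (w j)"
        by (simp add: Ew)
    qed
    then show ?thesis by simp
  qed
  have line: "\<exists>c. E i y = c *s w i" if "i \<le> d" for i y
  proof -
    interpret Ei: Vector_Spaces.linear scale scale "E i" by (rule E_lin[OF that])
    let ?r = "\<lambda>j. representation (w ` {..d}) y (w j)"
    have "E i y = E i (\<Sum>j\<le>d. ?r j *s w j)"
      by (simp add: basis_seq_expansion[OF basis])
    also have "\<dots> = (\<Sum>j\<le>d. if i = j then ?r i *s w i else 0)"
      unfolding Ei.sum Ei.scale using that by (intro sum.cong) (auto simp: Ew)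
    also have "\<dots> = ?r i *s w i" using that by simp
    finally show ?thesis by blast
  qed
  show ?thesis
  proof (intro eigenline_resolution.intro eigenline_resolution_axioms.intro vector_space_axioms)
    show "\<exists>c. E i y = c *s E i x" if "i \<le> d" "E i x \<noteq> 0" for i x y
    proof -
      obtain a b where ab: "E i x = a *s w i" "E i y = b *s w i"
        using line[OF \<open>i \<le> d\<close>] by metis
      then have "E i y = (b / a) *s E i x"
        using that(2) by auto
      then show ?thesis ..
    qed
  qed (use lin E_lin XE EE sum inj in blast)+
qed

text \<open>In an irreducible tridiagonal matrix the entries below the subdiagonal vanish and those on it do
  not, so \<open>Y\<close> raises the index \<open>j < d\<close> of an eigenline by exactly one.\<close>

lemma standard_ordering_raises:
  assumes res: "eigenline_resolution scale d X E \<theta>"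
    and ord: "standard_ordering scale d X Y E"
    and Y: "Vector_Spaces.linear scale scale Y"
    and j: "j \<le> d" and nz: "E j x \<noteq> 0"
  shows "\<And>i. i \<le> d \<Longrightarrow> Suc j < i \<Longrightarrow> E i (Y (E j x)) = 0"
    and "j < d \<Longrightarrow> E (Suc j) (Y (E j x)) \<noteq> 0"
proof -
  interpret X: eigenline_resolution scale d X E \<theta> by fact
  interpret Y: Vector_Spaces.linear scale scale Y by (rule Y)
  have "\<exists>w. w \<in> range (E i) \<and> w \<noteq> 0" if "i \<le> d" for i
    by (rule standard_ordering_range_nontrivial[OF X.linear_X ord that])
  then obtain w0 where w0: "\<And>i. i \<le> d \<Longrightarrow> w0 i \<in> range (E i) \<and> w0 i \<noteq> 0"
    by metis
  define w where "w = w0(j := E j x)"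
  have w: "w i \<in> range (E i) \<and> w i \<noteq> 0" if "i \<le> d" for i
    using w0[OF that] nz by (auto simp: w_def)
  let ?M = "matrix_of scale d w Y"
  have basis: "basis_seq scale d w" and tri: "irreducible_tridiagonal_mat ?M"
    using ord w by (auto simp: standard_ordering_def)
  have Ew: "E i (w k) = (if i = k then w i else 0)" if "i \<le> d" "k \<le> d" for i k
  proof -
    obtain y where "w k = E k y" using w[OF \<open>k \<le> d\<close>] by auto
    then show ?thesis using X.E_E[OF that] by auto
  qed
  have entry: "E i (Y (E j x)) = ?M $$ (i, j) *s w i" if "i \<le> d" for i
  proof -
    have "Y (E j x) = (\<Sum>k\<le>d. ?M $$ (k, j) *s w k)"
      using matrix_of_column[OF basis j, of Y] by (simp add: w_def)
    then have "E i (Y (E j x)) = (\<Sum>k\<le>d. if i = k then ?M $$ (i, j) *s w i else 0)"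
      using that by (simp add: X.E_sum X.E_scale Ew if_distrib cong: if_cong)
    then show ?thesis using that by simp
  qed
  have dim: "dim_row ?M = d + 1" by (simp add: matrix_of_def)
  show "E i (Y (E j x)) = 0" if "i \<le> d" "Suc j < i" for i
  proof -
    have "?M $$ (i, j) \<noteq> 0 \<longrightarrow> i = j \<or> i = Suc j \<or> j = Suc i"
      using tri that(1) j dim unfolding irreducible_tridiagonal_mat_def by auto
    then show ?thesis using entry[OF that(1)] that(2) by auto
  qed
  show "E (Suc j) (Y (E j x)) \<noteq> 0" if "j < d"
    using tri entry[of "Suc j"] that dim w[of "Suc j"] by (auto simp: irreducible_tridiagonal_mat_def)
qed

end

section \<open>The split basis and the map \<open>T\<close>\<close>

text \<open>The data of a self-dual Leonard system in the form in which the argument uses it. Self-duality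
  appears as the common eigenvalue sequence of \<open>A\<close> and \<open>As\<close> and as \<open>A_eta_dual\<close>, the image of
  \<open>As_eta\<close> under the automorphism. The Leonard pair property appears as the two raising conditions:
  \<open>A\<close> raises the index of an \<open>As\<close>-eigenline by at most one, and by exactly one for \<open>j < d\<close>.\<close>

locale self_dual_split =
  A: eigenline_resolution scale d A E \<theta> + As: eigenline_resolution scale d As Es \<theta>
  for scale :: "'a::field \<Rightarrow> 'b::ab_group_add \<Rightarrow> 'b" (infixr \<open>*s\<close> 75)
    and d A E As Es \<theta> +
  fixes v :: 'b and varphi phi :: "nat \<Rightarrow> 'a"
  assumes v_fixed: "Es 0 v = v" and v_nonzero: "v \<noteq> 0"
    and raise_at_most_one: "j \<le> d \<Longrightarrow> Es j x \<noteq> 0 \<Longrightarrow> i \<le> d \<Longrightarrow> Suc j < i \<Longrightarrow> Es i (A (Es j x)) = 0"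
    and raise_nonzero: "j < d \<Longrightarrow> Es j x \<noteq> 0 \<Longrightarrow> Es (Suc j) (A (Es j x)) \<noteq> 0"
    and As_tau: "i \<in> {1..d} \<Longrightarrow> As (poly_map scale (tau \<theta> i) A v)
      = \<theta> i *s poly_map scale (tau \<theta> i) A v + varphi i *s poly_map scale (tau \<theta> (i - 1)) A v"
    and As_eta: "i \<in> {1..d} \<Longrightarrow> As (poly_map scale (eta d \<theta> i) A v)
      = \<theta> i *s poly_map scale (eta d \<theta> i) A v + phi i *s poly_map scale (eta d \<theta> (i - 1)) A v"
    and A_eta_dual: "i \<in> {1..d} \<Longrightarrow> w \<in> range (E 0) \<Longrightarrow> w \<noteq> 0 \<Longrightarrow>
      A (poly_map scale (eta d \<theta> i) As w)
      = \<theta> i *s poly_map scale (eta d \<theta> i) As w + phi i *s poly_map scale (eta d \<theta> (i - 1)) As w"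
    and phi_nonzero: "i \<in> {1..d} \<Longrightarrow> phi i \<noteq> 0"
begin

definition u :: "nat \<Rightarrow> 'b" where
  "u i = poly_map scale (eta d \<theta> i) A v"

definition t :: "nat \<Rightarrow> 'b" where
  "t i = poly_map scale (tau \<theta> i) A v"

definition phi_prod :: "nat \<Rightarrow> 'a" where
  "phi_prod i = (\<Prod>j=1..i. phi j)"

sublocale lA: Vector_Spaces.linear scale scale A by (rule A.linear_X)
sublocale lAs: Vector_Spaces.linear scale scale As by (rule As.linear_X)

lemma u_0 [simp]: "u 0 = v" and t_0 [simp]: "t 0 = v"
  by (simp_all add: u_def t_def)

lemma u_Suc: "u (Suc i) = A (u i) - \<theta> (d - i) *s u i"
  by (simp only: u_def eta_Suc A.poly_map_times_root[OF A.linear_X])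

lemma t_Suc: "t (Suc i) = A (t i) - \<theta> i *s t i"
  by (simp only: t_def tau_Suc A.poly_map_times_root[OF A.linear_X])

lemma A_u: "A (u i) = \<theta> (d - i) *s u i + u (Suc i)"
  by (simp add: u_Suc)

lemma As_v: "As v = \<theta> 0 *s v"
  by (metis As.X_E le0 v_fixed)

lemma As_u_Suc: "i < d \<Longrightarrow> As (u (Suc i)) = \<theta> (Suc i) *s u (Suc i) + phi (Suc i) *s u i"
  using As_eta[of "Suc i"] by (simp add: u_def)

lemma As_t_Suc: "i < d \<Longrightarrow> As (t (Suc i)) = \<theta> (Suc i) *s t (Suc i) + varphi (Suc i) *s t i"
  using As_tau[of "Suc i"] by (simp add: t_def)

lemma phi_prod_0 [simp]: "phi_prod 0 = 1" and phi_prod_Suc: "phi_prod (Suc i) = phi_prod i * phi (Suc i)"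
  by (simp_all add: phi_prod_def)

lemma phi_prod_nonzero: "i \<le> d \<Longrightarrow> phi_prod i \<noteq> 0"
  using phi_nonzero by (auto simp: phi_prod_def)

lemma \<theta>_eq_iff: "i \<le> d \<Longrightarrow> j \<le> d \<Longrightarrow> \<theta> i = \<theta> j \<longleftrightarrow> i = j"
  using A.inj_\<theta> by (auto dest: inj_onD)

lemma poly_tau_top_nonzero: "poly (tau \<theta> d) (\<theta> d) \<noteq> 0"
  using \<theta>_eq_iff by (auto simp: poly_tau)

lemma poly_eta_top_nonzero: "poly (eta d \<theta> d) (\<theta> 0) \<noteq> 0"
  using \<theta>_eq_iff by (auto simp: poly_eta)

lemma poly_tau_root: "i < d \<Longrightarrow> poly (tau \<theta> d) (\<theta> i) = 0"
  by (auto simp: poly_tau)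

lemma poly_eta_root: "d - i < j \<Longrightarrow> i \<le> d \<Longrightarrow> poly (eta d \<theta> j) (\<theta> i) = 0"
  by (auto simp: poly_eta intro!: bexI[of _ "d - i"])

text \<open>Each of the polynomials \<open>\<tau>\<^sub>d\<close> and \<open>\<eta>\<^sub>d\<close> vanishes at all eigenvalues but one, so at \<open>A\<close> or \<open>As\<close> it
  is a multiple of a primitive idempotent.\<close>

lemma tau_top: "poly_map scale (tau \<theta> d) A w = poly (tau \<theta> d) (\<theta> d) *s E d w"
  by (rule A.eq_if_components_eq)
    (auto simp: A.E_poly_map A.E_scale A.E_E poly_tau_root)

lemma eta_top: "poly_map scale (eta d \<theta> d) A w = poly (eta d \<theta> d) (\<theta> 0) *s E 0 w"
  by (rule A.eq_if_components_eq)
    (auto simp: A.E_poly_map A.E_scale A.E_E poly_eta_root)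

lemma tau_top_dual: "poly_map scale (tau \<theta> d) As w = poly (tau \<theta> d) (\<theta> d) *s Es d w"
  by (rule As.eq_if_components_eq)
    (auto simp: As.E_poly_map As.E_scale As.E_E poly_tau_root)

lemma u_beyond [simp]: "u (Suc d) = 0"
  by (rule A.eq_if_components_eq) (auto simp: u_def A.E_poly_map poly_eta_root)

text \<open>\<open>flag k\<close> is the sum of the first \<open>k\<close> eigenlines of \<open>As\<close>. Relative to this flag \<open>A\<close> is a
  Hessenberg map, and its leading part does not change when a scalar is subtracted.\<close>

definition flag :: "nat \<Rightarrow> 'b set" where
  "flag k = {w. \<forall>j\<le>d. k \<le> j \<longrightarrow> Es j w = 0}"

lemma raise_zero:
  assumes "j \<le> d" "i \<le> d" "Suc j < i"
  shows "Es i (A (Es j x)) = 0"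
  using raise_at_most_one[OF assms(1) _ assms(2,3)] assms lA.zero by (cases "Es j x = 0") auto

lemma flag_A:
  assumes "w \<in> flag (Suc k)" "k < d"
  shows "A w - c *s w \<in> flag (Suc (Suc k))"
    and "Es (Suc k) (A w - c *s w) = Es (Suc k) (A (Es k w))"
proof -
  have Aw: "Es i (A w) = (\<Sum>j\<le>k. Es i (A (Es j w)))" if "i \<le> d" for i
  proof -
    have "w = (\<Sum>j\<le>d. Es j w)" by (simp add: As.sum_E)
    also have "\<dots> = (\<Sum>j\<le>k. Es j w)"
      using assms by (intro sum.mono_neutral_right) (auto simp: flag_def)
    finally have "Es i (A w) = Es i (A (\<Sum>j\<le>k. Es j w))" by simp
    then show ?thesis using that by (simp add: lA.sum As.E_sum)
  qed
  show "A w - c *s w \<in> flag (Suc (Suc k))"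
    unfolding flag_def
  proof (intro CollectI allI impI)
    fix i assume i: "i \<le> d" "Suc (Suc k) \<le> i"
    have "Es i (A (Es j w)) = 0" if "j \<le> k" for j
      using raise_zero[of j i w] that i assms(2) by simp
    moreover have "Es i w = 0" using assms(1) i by (simp add: flag_def)
    ultimately show "Es i (A w - c *s w) = 0"
      using i by (simp add: As.E_diff As.E_scale Aw)
  qed
  have "Es (Suc k) (A (Es j w)) = 0" if "j \<le> k" "j \<noteq> k" for j
    using raise_zero[of j "Suc k" w] that assms(2) by simp
  then have "(\<Sum>j\<le>k. Es (Suc k) (A (Es j w))) = (\<Sum>j\<in>{k}. Es (Suc k) (A (Es j w)))"
    by (intro sum.mono_neutral_right) auto
  moreover have "Es (Suc k) w = 0" using assms by (simp add: flag_def)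
  ultimately show "Es (Suc k) (A w - c *s w) = Es (Suc k) (A (Es k w))"
    using assms(2) by (simp add: As.E_diff As.E_scale Aw)
qed

lemma v_flag: "v \<in> flag (Suc 0)"
proof -
  have "Es j v = 0" if "j \<le> d" "1 \<le> j" for j
    using As.E_E[OF that(1), of 0 v] that(2) v_fixed by simp
  then show ?thesis by (simp add: flag_def)
qed

text \<open>A polynomial of degree \<open>i\<close> in \<open>A\<close> takes \<open>v\<close> exactly to level \<open>i\<close> of the flag, and the leading
  component depends only on the leading coefficient. Therefore \<open>u\<close> is adapted to the flag, hence a
  basis, and \<open>t d\<close> has the same component in the last eigenline as \<open>u d\<close>.\<close>

lemma u_flag:
  assumes "i \<le> d"
  shows "u i \<in> flag (Suc i) \<and> Es i (u i) \<noteq> 0"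
  using assms
proof (induction i)
  case 0
  then show ?case using v_flag v_fixed v_nonzero by simp
next
  case (Suc i)
  then have *: "u i \<in> flag (Suc i)" "Es i (u i) \<noteq> 0" "i < d" by auto
  then show ?case
    using flag_A[of "u i" i "\<theta> (d - i)"] raise_nonzero[of i "u i"] by (simp add: u_Suc)
qed

lemma t_flag:
  assumes "i \<le> d"
  shows "t i \<in> flag (Suc i) \<and> Es i (t i) = Es i (u i)"
  using assms
proof (induction i)
  case 0
  then show ?case using v_flag by simp
next
  case (Suc i)
  then have "t i \<in> flag (Suc i)" "Es i (t i) = Es i (u i)" "u i \<in> flag (Suc i)" "i < d"
    using u_flag[of i] by auto
  then show ?case
    using flag_A[of "t i" i "\<theta> i"] flag_A[of "u i" i "\<theta> (d - i)"] by (simp add: u_Suc t_Suc)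
qed

text \<open>The vectors \<open>u i\<close> span \<open>V\<close>, as one sees by clearing leading components along the flag.\<close>

lemma linear_eq_on_u:
  assumes F: "Vector_Spaces.linear scale scale F" and G: "Vector_Spaces.linear scale scale G"
    and eq: "\<And>i. i \<le> d \<Longrightarrow> F (u i) = G (u i)"
  shows "F w = G w"
proof -
  interpret F: Vector_Spaces.linear scale scale F by (rule F)
  interpret G: Vector_Spaces.linear scale scale G by (rule G)
  have "\<forall>w \<in> flag k. F w = G w" if "k \<le> Suc d" for k
    using that
  proof (induction k)
    case 0
    have zero: "w = 0" if "w \<in> flag 0" for w
      by (rule As.eq_if_components_eq) (use that in \<open>auto simp: flag_def\<close>)
    show ?case
    proof
      fix w assume "w \<in> flag 0"
      then have "w = 0" by (rule zero)
      then show "F w = G w" by simp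
    qed
  next
    case (Suc k)
    show ?case
    proof
      fix w assume w: "w \<in> flag (Suc k)"
      have k: "k \<le> d" using Suc.prems by simp
      obtain c where c: "Es k w = c *s Es k (u k)"
        using As.line_E[OF k] u_flag[OF k] by blast
      have "w - c *s u k \<in> flag k"
        unfolding flag_def
      proof (intro CollectI allI impI)
        fix j assume j: "j \<le> d" "k \<le> j"
        show "Es j (w - c *s u k) = 0"
        proof (cases "j = k")
          case True
          then show ?thesis using c k by (simp add: As.E_diff As.E_scale)
        next
          case False
          then show ?thesis
            using w u_flag[OF k] j by (simp add: flag_def As.E_diff As.E_scale)
        qed
      qed
      then have "F (w - c *s u k) = G (w - c *s u k)"
        using Suc by simp
      then show "F w = G w"
        using eq[OF k] by (simp add: F.diff F.scale G.diff G.scale)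
    qed
  qed
  moreover have "w \<in> flag (Suc d)" by (simp add: flag_def)
  ultimately show ?thesis by blast
qed

lemma u_nonzero: "i \<le> d \<Longrightarrow> u i \<noteq> 0"
  using u_flag[of i] As.E_zero by auto

lemma u_d: "u d = poly (eta d \<theta> d) (\<theta> 0) *s E 0 v"
  by (simp add: u_def eta_top)

lemma t_d: "t d = poly (tau \<theta> d) (\<theta> d) *s E d v"
  by (simp add: t_def tau_top)

text \<open>Reading the split relations from the top: \<open>As - \<theta> i\<close> maps \<open>u i\<close> to a multiple of \<open>u (i - 1)\<close>,
  so applying the factors of \<open>\<eta>\<^sub>i(As)\<close> to \<open>u d\<close> descends the basis \<open>u\<close> step by step.\<close>

lemma eta_As_u_d:
  assumes "i \<le> d"
  shows "phi_prod (d - i) *s poly_map scale (eta d \<theta> i) As (u d) = phi_prod d *s u (d - i)"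
  using assms
proof (induction i)
  case 0
  then show ?case by simp
next
  case (Suc i)
  define k where "k = d - Suc i"
  have k: "d - i = Suc k" "k < d" using Suc.prems by (auto simp: k_def)
  let ?y = "poly_map scale (eta d \<theta> i) As (u d)"
  have IH: "phi_prod (Suc k) *s ?y = phi_prod d *s u (Suc k)" using Suc k by simp
  have step: "poly_map scale (eta d \<theta> (Suc i)) As (u d) = As ?y - \<theta> (Suc k) *s ?y"
    by (simp only: eta_Suc A.poly_map_times_root[OF As.linear_X] k)
  have "phi (Suc k) *s (phi_prod k *s poly_map scale (eta d \<theta> (Suc i)) As (u d))
      = phi_prod (Suc k) *s (As ?y - \<theta> (Suc k) *s ?y)"
    by (simp only: step phi_prod_Suc A.scale_scale mult.commute)
  also have "\<dots> = As (phi_prod (Suc k) *s ?y) - \<theta> (Suc k) *s (phi_prod (Suc k) *s ?y)"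
    by (simp only: lAs.scale A.scale_right_diff_distrib A.scale_scale mult.commute)
  also have "\<dots> = phi_prod d *s (phi (Suc k) *s u k)"
    unfolding IH lAs.scale As_u_Suc[OF k(2)] A.scale_right_distrib
    by (simp only: A.scale_scale mult.commute) simp
  also have "\<dots> = phi (Suc k) *s (phi_prod d *s u k)"
    by (simp only: A.scale_scale mult.commute)
  finally show ?case
    using phi_nonzero[of "Suc k"] k by (simp add: k_def[symmetric] del: A.scale_scale)
qed

text \<open>Here self-duality contributes more than the equality of the eigenvalues. The vector
  \<open>u d\<close> lies in \<open>E 0 V\<close>, so the vectors \<open>\<eta>\<^sub>i(As)(u d)\<close> satisfy the dual split relations with
  coefficients \<open>phi i\<close>. They are also multiples of the \<open>u (d - i)\<close>, on which \<open>A\<close> acts in a known way;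
  this gives the coefficients \<open>phi (d - i + 1)\<close>.\<close>

lemma phi_symmetric:
  assumes "i < d"
  shows "phi (Suc i) = phi (d - i)"
proof -
  define k where "k = d - Suc i"
  have k: "d - i = Suc k" "k < d" "d - k = Suc i" "d - Suc k = i" using assms by (auto simp: k_def)
  let ?y = "\<lambda>j. poly_map scale (eta d \<theta> j) As (u d)"
  have y: "?y j = (phi_prod d / phi_prod (d - j)) *s u (d - j)" if "j \<le> d" for j
  proof -
    have "?y j = (1 / phi_prod (d - j)) *s (phi_prod (d - j) *s ?y j)"
      using phi_prod_nonzero[of "d - j"] by simp
    then show ?thesis by (simp only: eta_As_u_d[OF that]) simp
  qed
  have "u d \<in> range (E 0)"
    by (metis u_d A.E_scale le0 rangeI)
  from A_eta_dual[OF _ this u_nonzero[OF order_refl], of "Suc i"]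
  have "A (?y (Suc i)) = \<theta> (Suc i) *s ?y (Suc i) + phi (Suc i) *s ?y i"
    using assms by simp
  moreover have "A (?y (Suc i)) = \<theta> (Suc i) *s ?y (Suc i) + (phi_prod d / phi_prod k) *s u (Suc k)"
    using assms k by (simp add: y k_def[symmetric] lA.scale A_u A.scale_right_distrib mult_ac)
  ultimately have "(phi_prod d / phi_prod k) *s u (Suc k) = phi (Suc i) *s ((phi_prod d / phi_prod (Suc k)) *s u (Suc k))"
    using y[of i] assms k by simp
  then have "phi_prod d / phi_prod k = phi (Suc i) * (phi_prod d / phi_prod (Suc k))"
    using u_nonzero[of "Suc k"] k(2) by simp
  then show ?thesis
    using phi_prod_nonzero[of k] phi_prod_nonzero[of d] phi_prod_nonzero[of "Suc k"] k
    by (simp add: phi_prod_Suc field_simps)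
qed

definition T :: "'b \<Rightarrow> 'b" where
  "T w = (\<Sum>i\<le>d. poly_map scale (eta d \<theta> (d - i)) A (Es 0 (E d (poly_map scale (tau \<theta> i) As w))))"

lemma linear_T: "Vector_Spaces.linear scale scale T"
proof -
  have 1: "Vector_Spaces.linear scale scale (poly_map scale p A)"
    and 2: "Vector_Spaces.linear scale scale (poly_map scale p As)" for p
    by (rule A.linear_poly_map A.linear_X As.linear_X)+
  show ?thesis
    unfolding T_def using 1 2 As.linear_E[of 0] A.linear_E[of d]
    by (simp add: Vector_Spaces.linear_iff sum.distrib A.scale_sum_right)
qed

sublocale lT: Vector_Spaces.linear scale scale T by (rule linear_T)

text \<open>Up to scalars, the functionals \<open>w \<mapsto> E d (\<tau>\<^sub>i(As) w)\<close> form the basis dual to \<open>u\<close>. For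
  \<open>i = 0\<close> this holds because \<open>\<eta>\<^sub>j(A)\<close> with \<open>j > 0\<close> kills the eigenline of \<open>\<theta> d\<close>; each further factor
  \<open>As - \<theta> i\<close> shifts the index by one.\<close>

lemma E_d_tau_u:
  assumes "i \<le> d" "j \<le> d"
  shows "E d (poly_map scale (tau \<theta> i) As (u j)) = (if i = j then phi_prod j *s E d v else 0)"
  using assms
proof (induction i arbitrary: j)
  case 0
  have "E d (u j) = 0" if "j \<noteq> 0"
    using that by (simp add: u_def A.E_poly_map poly_eta_root)
  then show ?case by simp
next
  case (Suc i)
  interpret q: Vector_Spaces.linear scale scale "poly_map scale (tau \<theta> i) As"
    by (rule A.linear_poly_map[OF As.linear_X])
  have step: "poly_map scale (tau \<theta> (Suc i)) As w
      = poly_map scale (tau \<theta> i) As (As w) - \<theta> i *s poly_map scale (tau \<theta> i) As w" for w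
    by (simp only: tau_Suc A.poly_map_times_root[OF As.linear_X]
        A.poly_map_commute[OF As.linear_X])
  show ?case
  proof (cases j)
    case 0
    then show ?thesis
      using Suc.IH[of 0] Suc.prems
      by (auto simp: step As_v q.scale A.E_diff A.E_scale)
  next
    case (Suc k)
    then show ?thesis
      using Suc.IH[of j] Suc.IH[of k] Suc.prems
      by (auto simp: step As_u_Suc q.add q.scale A.E_diff A.E_add A.E_scale phi_prod_Suc mult_ac)
  qed
qed

text \<open>The map \<open>Es 0 \<circ> E d\<close> sends \<open>v\<close> to \<open>C v\<close>; this scalar is also the trace of \<open>Es 0 \<circ> E d\<close>.\<close>

definition C :: 'a where
  "C = (SOME c. Es 0 (E d v) = c *s v)"

lemma C: "Es 0 (E d v) = C *s v"
proof -
  have "\<exists>c. Es 0 (E d v) = c *s v"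
    using As.line_E[of 0 v] v_fixed v_nonzero by auto
  then show ?thesis unfolding C_def by (rule someI_ex)
qed

text \<open>By duality only one summand of \<open>T\<close> survives on \<open>u j\<close>, so \<open>T\<close> reverses the basis \<open>u\<close> up to
  scalars.\<close>

lemma T_u:
  assumes "j \<le> d"
  shows "T (u j) = (C * phi_prod j) *s u (d - j)"
proof -
  interpret q: Vector_Spaces.linear scale scale "poly_map scale (eta d \<theta> (d - j)) A"
    by (rule A.linear_poly_map[OF A.linear_X])
  have "T (u j) = (\<Sum>i\<le>d. if i = j then (C * phi_prod j) *s u (d - j) else 0)"
    unfolding T_def
    by (rule sum.cong)
      (use assms in \<open>auto simp: E_d_tau_u As.E_scale C q.scale u_def[symmetric] A.poly_map_at_0 A.linear_X mult.commute\<close>)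
  then show ?thesis using assms by simp
qed

text \<open>On the basis \<open>u\<close> both sides are explicit: \<open>A\<close> is lower and \<open>As\<close> is upper bidiagonal, and
  reversing the basis interchanges the two shapes. Here the off-diagonal coefficients agree
  because \<open>phi_prod\<close> absorbs them.\<close>

lemma T_As: "T (As w) = A (T w)"
proof -
  have "(T \<circ> As) w = (A \<circ> T) w"
  proof (rule linear_eq_on_u[where F = "T \<circ> As" and G = "A \<circ> T"])
    fix j assume "j \<le> d"
    show "(T \<circ> As) (u j) = (A \<circ> T) (u j)"
    proof (cases j)
      case 0
      have "A (u d) = \<theta> 0 *s u d" by (simp add: A_u)
      then show ?thesis using 0 T_u[of 0] by (simp add: As_v lT.scale lA.scale mult.commute)
    next
      case (Suc k)
      then have k: "k < d" "Suc (d - Suc k) = d - k" "d - (d - Suc k) = Suc k"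
        using \<open>j \<le> d\<close> by auto
      then show ?thesis
        using Suc T_u[of k] T_u[of "Suc k"]
        by (simp add: As_u_Suc lT.add lT.scale lA.scale A_u A.scale_right_distrib phi_prod_Suc mult_ac)
    qed
  qed (rule Vector_Spaces.linear_compose linear_T A.linear_X As.linear_X)+
  then show ?thesis by simp
qed

text \<open>In this direction the off-diagonal coefficients match only by the symmetry of \<open>phi\<close>.\<close>

lemma T_A: "T (A w) = As (T w)"
proof -
  have "(T \<circ> A) w = (As \<circ> T) w"
  proof (rule linear_eq_on_u[where F = "T \<circ> A" and G = "As \<circ> T"])
    fix j assume j: "j \<le> d"
    show "(T \<circ> A) (u j) = (As \<circ> T) (u j)"
    proof (cases "j = d")
      case True
      then show ?thesis
        using T_u[of d] by (simp add: A_u lT.add lT.scale lAs.scale As_v mult.commute)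
    next
      case False
      define k where "k = d - Suc j"
      have k: "j < d" "d - j = Suc k" "d - Suc j = k" "k < d" using j False by (auto simp: k_def)
      then show ?thesis
        using T_u[of j] T_u[of "Suc j"] phi_symmetric[of j]
        by (simp add: As_u_Suc A_u lT.add lT.scale lAs.scale A.scale_right_distrib phi_prod_Suc mult_ac)
    qed
  qed (rule Vector_Spaces.linear_compose linear_T A.linear_X As.linear_X)+
  then show ?thesis by simp
qed

text \<open>The component of \<open>t i\<close> in \<open>Es 0 V\<close> follows from the first split relations, one step at a time.\<close>

lemma Es_0_t:
  assumes "i \<le> d"
  shows "(\<Prod>j=1..i. \<theta> 0 - \<theta> j) *s Es 0 (t i) = (\<Prod>j=1..i. varphi j) *s v"
  using assms
proof (induction i)
  case 0
  then show ?case by (simp add: v_fixed)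
next
  case (Suc i)
  have "\<theta> 0 *s Es 0 (t (Suc i)) = \<theta> (Suc i) *s Es 0 (t (Suc i)) + varphi (Suc i) *s Es 0 (t i)"
    using As.E_X[of 0 "t (Suc i)"] As_t_Suc[of i] Suc.prems by (simp add: As.E_add As.E_scale)
  then have step: "(\<theta> 0 - \<theta> (Suc i)) *s Es 0 (t (Suc i)) = varphi (Suc i) *s Es 0 (t i)"
    by (simp add: A.scale_left_diff_distrib)
  have "(\<Prod>j=1..Suc i. \<theta> 0 - \<theta> j) *s Es 0 (t (Suc i))
      = (\<Prod>j=1..i. \<theta> 0 - \<theta> j) *s ((\<theta> 0 - \<theta> (Suc i)) *s Es 0 (t (Suc i)))"
    by simp
  also have "\<dots> = varphi (Suc i) *s ((\<Prod>j=1..i. \<theta> 0 - \<theta> j) *s Es 0 (t i))"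
    by (simp only: step A.scale_scale mult.commute)
  also have "\<dots> = varphi (Suc i) *s ((\<Prod>j=1..i. varphi j) *s v)"
    using Suc by simp
  finally show ?case by (simp add: mult.commute)
qed

text \<open>The vector \<open>t d\<close> is a multiple of \<open>E d v\<close>, so its component in \<open>Es 0 V\<close> can be computed from
  \<open>C\<close> and also from the first split sequence.\<close>

lemma C_product:
  "C * poly (tau \<theta> d) (\<theta> d) * poly (eta d \<theta> d) (\<theta> 0) = (\<Prod>i=1..d. varphi i)"
proof -
  have "(\<Prod>j=1..d. \<theta> 0 - \<theta> j) = (\<Prod>j<d. \<theta> 0 - \<theta> (d - j))"
    by (rule prod.reindex_bij_witness[of _ "\<lambda>j. d - j" "\<lambda>j. d - j"]) auto
  then have "poly (eta d \<theta> d) (\<theta> 0) *s Es 0 (t d) = (\<Prod>i=1..d. varphi i) *s v"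
    using Es_0_t[of d] by (simp add: poly_eta)
  then have "(C * poly (tau \<theta> d) (\<theta> d) * poly (eta d \<theta> d) (\<theta> 0)) *s v = (\<Prod>i=1..d. varphi i) *s v"
    by (simp add: t_d As.E_scale C mult_ac)
  then show ?thesis using v_nonzero by (simp only: A.scale_cancel_right) simp
qed

lemma T_E: "i \<le> d \<Longrightarrow> T (E i w) = Es i (T w)"
  by (rule intertwine_idempotents[OF A.eigenline_resolution_axioms As.eigenline_resolution_axioms
        linear_T T_A])

lemma T_Es: "i \<le> d \<Longrightarrow> T (Es i w) = E i (T w)"
  by (rule intertwine_idempotents[OF As.eigenline_resolution_axioms A.eigenline_resolution_axioms
        linear_T T_As])

text \<open>By \<open>C_product\<close>, these are \<open>C \<eta>\<^sub>d(\<theta>\<^sub>0)\<close> and \<open>C \<tau>\<^sub>d(\<theta>\<^sub>d)\<close>.\<close>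

definition K0 :: 'a where "K0 = (\<Prod>i=1..d. varphi i) / poly (tau \<theta> d) (\<theta> d)"
definition Kd :: 'a where "Kd = (\<Prod>i=1..d. varphi i) / poly (eta d \<theta> d) (\<theta> 0)"

text \<open>It suffices to treat \<open>v\<close>, which \<open>T\<close> maps to \<open>C u d\<close>.\<close>

lemma T_Es_0:
  assumes "Es 0 w = w"
  shows "T w = K0 *s E 0 w"
proof -
  have K: "K0 = C * poly (eta d \<theta> d) (\<theta> 0)"
    unfolding K0_def C_product[symmetric] using poly_tau_top_nonzero by simp
  have "T v = K0 *s E 0 v"
    using T_u[of 0] by (simp add: K u_d)
  moreover obtain c where "w = c *s v"
    using As.line_multiple[of 0 v w] assms v_fixed v_nonzero by auto
  ultimately show ?thesis by (simp add: lT.scale A.E_scale mult.commute)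
qed

text \<open>It suffices to treat \<open>t d = \<tau>\<^sub>d(A) v\<close>. Its image is \<open>C \<tau>\<^sub>d(As)(u d)\<close>, a multiple of
  \<open>Es d (u d)\<close>; this equals \<open>Es d (t d)\<close> because \<open>\<tau>\<^sub>d\<close> and \<open>\<eta>\<^sub>d\<close> are both monic of degree \<open>d\<close>.\<close>

lemma T_E_d:
  assumes "E d w = w"
  shows "T w = Kd *s Es d w"
proof -
  have K: "Kd = C * poly (tau \<theta> d) (\<theta> d)"
    unfolding Kd_def C_product[symmetric] using poly_eta_top_nonzero by simp
  have "T (t d) = poly_map scale (tau \<theta> d) As (T v)"
    unfolding t_def by (rule A.poly_map_intertwine[OF A.linear_X As.linear_X linear_T T_A])
  also have "\<dots> = poly (tau \<theta> d) (\<theta> d) *s Es d (C *s u d)"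
    using T_u[of 0] by (simp add: tau_top_dual)
  also have "\<dots> = Kd *s Es d (t d)"
    using t_flag[of d] by (simp add: As.E_scale K mult.commute)
  finally have Tt: "T (t d) = Kd *s Es d (t d)" .
  have "t d \<noteq> 0" using t_flag[of d] u_flag[of d] As.E_zero by auto
  moreover have "E d (t d) = t d" by (simp add: t_d A.E_scale)
  ultimately obtain c where "w = c *s t d"
    using A.line_multiple[of d "t d" w] assms by auto
  then show ?thesis by (simp add: lT.scale As.E_scale Tt mult.commute)
qed

text \<open>The eigenline \<open>E 0 V\<close> is spanned by \<open>E 0 v\<close>, so the formula for \<open>v\<close> can be transported by \<open>Es 0\<close>,
  since \<open>T \<circ> E 0 = Es 0 \<circ> T\<close>. The next lemma transports the formula for \<open>t d\<close> in the same way.\<close>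

lemma T_E_0:
  assumes "E 0 w = w"
  shows "T w = K0 *s Es 0 w"
proof -
  have "E 0 v \<noteq> 0" using u_nonzero[of d] by (auto simp: u_d)
  then obtain c where "w = c *s E 0 v"
    using A.line_multiple[of 0 "E 0 v" w] assms by auto
  moreover have "T (E 0 v) = K0 *s Es 0 (E 0 v)"
    using T_Es_0[OF v_fixed] by (simp add: T_E As.E_scale)
  ultimately show ?thesis by (simp add: lT.scale As.E_scale mult.commute)
qed

lemma T_Es_d:
  assumes "Es d w = w"
  shows "T w = Kd *s E d w"
proof -
  have "Es d (t d) \<noteq> 0" using t_flag[of d] u_flag[of d] by simp
  then obtain c where "w = c *s Es d (t d)"
    using As.line_multiple[of d "Es d (t d)" w] assms by auto
  moreover have "T (Es d (t d)) = Kd *s E d (Es d (t d))"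
    using T_E_d[of "t d"] by (simp add: T_Es A.E_scale t_d)
  ultimately show ?thesis by (simp add: lT.scale A.E_scale mult.commute)
qed

end

section \<open>Projections and the bilinear form\<close>

context eigenline_resolution
begin

lemma form_eigen_orthogonal:
  assumes form: "bilinear_form scale form" and sym: "\<And>x y. form (X x) y = form x (X y)"
    and ij: "i \<le> d" "j \<le> d" "i \<noteq> j"
  shows "form (E i x) (E j y) = 0"
proof -
  interpret l: Vector_Spaces.linear scale "(*)" "\<lambda>x. form x (E j y)"
    using form by (simp add: bilinear_form_def)
  interpret r: Vector_Spaces.linear scale "(*)" "form (E i x)"
    using form by (simp add: bilinear_form_def)
  have "\<theta> i * form (E i x) (E j y) = \<theta> j * form (E i x) (E j y)"
    using sym[of "E i x" "E j y"] ij by (simp add: X_E l.scale r.scale)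
  then show ?thesis using inj_onD[OF inj_\<theta>, of i j] ij by auto
qed

text \<open>Eigenvectors of a self-adjoint map for distinct eigenvalues are orthogonal, so pairing with an
  eigenvector sees only the component in the same eigenline.\<close>

lemma form_E:
  assumes form: "bilinear_form scale form" and sym: "\<And>x y. form (X x) y = form x (X y)"
    and "i \<le> d"
  shows "form (E i x) y = form (E i x) (E i y)" "form x (E i y) = form (E i x) (E i y)"
proof -
  interpret r: Vector_Spaces.linear scale "(*)" "form (E i x)"
    using form by (simp add: bilinear_form_def)
  interpret l: Vector_Spaces.linear scale "(*)" "\<lambda>x. form x (E i y)"
    using form by (simp add: bilinear_form_def)
  have "form (E i x) y = (\<Sum>j\<le>d. form (E i x) (E j y))"
    using r.sum[of "\<lambda>j. E j y" "{..d}"] by (simp add: sum_E)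
  also have "\<dots> = (\<Sum>j\<le>d. if i = j then form (E i x) (E i y) else 0)"
    using form_eigen_orthogonal[OF form sym \<open>i \<le> d\<close>] by (intro sum.cong) auto
  finally show "form (E i x) y = form (E i x) (E i y)" using \<open>i \<le> d\<close> by simp
  have "form x (E i y) = (\<Sum>j\<le>d. form (E j x) (E i y))"
    using l.sum[of "\<lambda>j. E j x" "{..d}"] by (simp add: sum_E)
  also have "\<dots> = (\<Sum>j\<le>d. if i = j then form (E i x) (E i y) else 0)"
    using form_eigen_orthogonal[OF form sym _ \<open>i \<le> d\<close>] by (intro sum.cong) auto
  finally show "form x (E i y) = form (E i x) (E i y)" using \<open>i \<le> d\<close> by simp
qed

text \<open>An eigenvector \<open>w\<close> is orthogonal to all other eigenlines, so it cannot be isotropic without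
  lying in the radical. Pairing with \<open>w\<close> therefore reads off the coefficient of the projection.\<close>

lemma projection_by_form:
  assumes form: "bilinear_form scale form" and sym: "\<And>x y. form (X x) y = form x (X y)"
    and nondeg: "\<forall>x. x \<noteq> 0 \<longrightarrow> (\<exists>y. form x y \<noteq> 0)"
    and i: "i \<le> d" and w: "w \<in> range (E i)" "w \<noteq> 0"
  shows "E i x = (form w x / form w w) *s w" "E i x = (form x w / form w w) *s w"
proof -
  have Ew: "E i w = w" using w i by auto
  interpret r: Vector_Spaces.linear scale "(*)" "form w"
    using form by (simp add: bilinear_form_def)
  interpret l: Vector_Spaces.linear scale "(*)" "\<lambda>x. form x w"
    using form by (simp add: bilinear_form_def)
  have multiple: "\<exists>c. E i y = c *s w" for y
    using line_E[OF i, of w y] Ew w(2) by simp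
  have left: "form w y = c * form w w" and right: "form y w = c * form w w"
    if "E i y = c *s w" for y c
  proof -
    have "form w y = form w (E i y)" "form y w = form (E i y) w"
      using form_E(1)[OF form sym i, of w y] form_E(2)[OF form sym i, of y w] Ew by metis+
    then show "form w y = c * form w w" "form y w = c * form w w"
      unfolding that r.scale l.scale by blast+
  qed
  have "form w w \<noteq> 0"
  proof
    assume zero: "form w w = 0"
    obtain y where y: "form w y \<noteq> 0" using nondeg[rule_format, OF w(2)] by (rule exE)
    obtain c where "E i y = c *s w" using multiple by (rule exE)
    from left[OF this] y zero show False by simp
  qed
  moreover obtain c where c: "E i x = c *s w" using multiple by (rule exE)
  ultimately have coeff: "c = form w x / form w w" "c = form x w / form w w"
    using left[OF c] right[OF c] by simp_all
  show "E i x = (form w x / form w w) *s w" using c unfolding coeff(1) .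
  show "E i x = (form x w / form w w) *s w" using c unfolding coeff(2) .
qed

end

text \<open>The left radical is stable under all of \<open>End(V)\<close>, which acts transitively on nonzero
  vectors; a nonzero radical would make the form vanish.\<close>

lemma (in vector_space) associated_form_nondegenerate:
  assumes "associated_form scale dag form" "x \<noteq> 0"
  shows "\<exists>y. form x y \<noteq> 0"
proof (rule ccontr)
  assume "\<nexists>y. form x y \<noteq> 0"
  then have x: "form x y = 0" for y by simp
  interpret vector_space_pair scale scale
    by (intro vector_space_pair.intro vector_space_axioms)
  have "form z y = 0" for z y
  proof -
    have "independent {x}" using assms(2) by simp
    then obtain Y where Y: "Vector_Spaces.linear scale scale Y" "Y x = z"
      using linear_independent_extend[of "{x}" "\<lambda>_. z"] by auto
    then have "form (Y x) y = form x (dag Y y)"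
      using assms(1) unfolding associated_form_def endos_def by blast
    then show ?thesis using x Y by simp
  qed
  then show False using assms(1) by (auto simp: associated_form_def)
qed

section \<open>Transport by the duality automorphism\<close>

context vector_space
begin

lemma automorphism_eigenrelation:
  assumes sd: "algebra_automorphism scale \<sigma>" "\<sigma> A = As" "\<sigma> P = Q"
    and A: "A \<in> endos scale" and P: "P \<in> endos scale"
    and AP: "\<And>w. A (P w) = c *s P w"
  shows "As (Q w) = c *s Q w"
proof -
  have "A \<circ> P = (\<lambda>w. c *s P w)" using AP by auto
  moreover have "\<sigma> (A \<circ> P) = \<sigma> A \<circ> \<sigma> P"
    using sd(1) A P by (simp add: algebra_automorphism_def)
  moreover have "\<sigma> (\<lambda>w. c *s P w) = (\<lambda>w. c *s \<sigma> P w)"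
    using sd(1) P by (simp add: algebra_automorphism_def linear_bijection_def)
  ultimately have "As \<circ> Q = (\<lambda>w. c *s Q w)" using sd by simp
  then show ?thesis by (simp add: fun_eq_iff)
qed

lemma automorphism_poly_map:
  assumes \<sigma>: "algebra_automorphism scale \<sigma>"
    and X: "X \<in> endos scale" and P: "P \<in> endos scale"
  shows "(\<lambda>w. poly_map scale p X (P w)) \<in> endos scale
    \<and> \<sigma> (\<lambda>w. poly_map scale p X (P w)) = (\<lambda>w. poly_map scale p (\<sigma> X) (\<sigma> P w))"
proof -
  have lin: "Vector_Spaces.linear scale scale X" "Vector_Spaces.linear scale scale P"
    using X P by (auto simp: endos_def)
  have mult: "\<sigma> (Y \<circ> Z) = \<sigma> Y \<circ> \<sigma> Z" and add: "\<sigma> (\<lambda>w. Y w + Z w) = (\<lambda>w. \<sigma> Y w + \<sigma> Z w)"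
    and scal: "\<sigma> (\<lambda>w. c *s Y w) = (\<lambda>w. c *s \<sigma> Y w)" and mem: "\<sigma> Y \<in> endos scale"
    if "Y \<in> endos scale" "Z \<in> endos scale" for Y Z c
    using \<sigma> that by (auto simp: algebra_automorphism_def linear_bijection_def bij_betw_def)
  have \<sigma>X: "Vector_Spaces.linear scale scale (\<sigma> X)"
    using mem[OF X X] by (simp add: endos_def)
  have closed: "(\<lambda>w. poly_map scale p X (P w)) \<in> endos scale" for p
    using Vector_Spaces.linear_compose[OF lin(2) linear_poly_map[OF lin(1), of p]]
    by (simp add: endos_def comp_def)
  show ?thesis
  proof (intro conjI closed, induction p)
    case 0
    have "\<sigma> (\<lambda>w. 0 *s P w) = (\<lambda>w. 0 *s \<sigma> P w)" by (rule scal[OF P P])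
    then show ?case by simp
  next
    case (pCons a p)
    let ?R = "\<lambda>w. poly_map scale p X (P w)"
    have R: "?R \<in> endos scale" by (rule closed)
    have aP: "(\<lambda>w. a *s P w) \<in> endos scale"
      using Vector_Spaces.linear_compose[OF lin(2) linear_scale_self] by (simp add: endos_def comp_def)
    have XR: "X \<circ> ?R \<in> endos scale"
      using Vector_Spaces.linear_compose[OF _ lin(1), of scale ?R] R by (simp add: endos_def)
    have "\<sigma> (\<lambda>w. poly_map scale (pCons a p) X (P w)) = \<sigma> (\<lambda>w. a *s P w + (X \<circ> ?R) w)"
      by (simp add: poly_map_pCons[OF lin(1)])
    also have "\<dots> = (\<lambda>w. a *s \<sigma> P w + \<sigma> X (\<sigma> ?R w))"
      using add[OF aP XR] scal[OF P P] mult[OF X R] by (simp add: comp_def)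
    also have "\<dots> = (\<lambda>w. poly_map scale (pCons a p) (\<sigma> X) (\<sigma> P w))"
      using pCons.IH by (simp add: poly_map_pCons[OF \<sigma>X])
    finally show ?case .
  qed
qed

text \<open>A relation valid on all of \<open>P V\<close> is an identity of endomorphisms, so the automorphism can be
  applied to it. This carries the split relations of the system to those of its dual.\<close>

lemma automorphism_split_relation:
  assumes \<sigma>: "algebra_automorphism scale \<sigma>"
    and endo: "A \<in> endos scale" "As \<in> endos scale" "P \<in> endos scale"
    and rel: "\<And>w. As (poly_map scale p A (P w))
      = a *s poly_map scale p A (P w) + b *s poly_map scale q A (P w)"
  shows "\<sigma> As (poly_map scale p (\<sigma> A) (\<sigma> P w))
      = a *s poly_map scale p (\<sigma> A) (\<sigma> P w) + b *s poly_map scale q (\<sigma> A) (\<sigma> P w)"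
proof -
  let ?p = "\<lambda>w. poly_map scale p A (P w)" and ?q = "\<lambda>w. poly_map scale q A (P w)"
  note p = automorphism_poly_map[OF \<sigma> endo(1,3), of p]
  note q = automorphism_poly_map[OF \<sigma> endo(1,3), of q]
  have scaled: "(\<lambda>w. c *s Y w) \<in> endos scale" if "Y \<in> endos scale" for c Y
    using Vector_Spaces.linear_compose[OF _ linear_scale_self, of scale Y c] that
    by (simp add: endos_def comp_def)
  have "As \<circ> ?p = (\<lambda>w. a *s ?p w + b *s ?q w)" using rel by auto
  then have "\<sigma> (As \<circ> ?p) = \<sigma> (\<lambda>w. a *s ?p w + b *s ?q w)" by simp
  moreover have "\<sigma> (As \<circ> ?p) = \<sigma> As \<circ> \<sigma> ?p"
    using \<sigma> endo p by (simp add: algebra_automorphism_def)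
  moreover have "\<sigma> (\<lambda>w. a *s ?p w + b *s ?q w) = (\<lambda>w. \<sigma> (\<lambda>w. a *s ?p w) w + \<sigma> (\<lambda>w. b *s ?q w) w)"
    using \<sigma> scaled p q by (simp add: algebra_automorphism_def linear_bijection_def)
  moreover have "\<sigma> (\<lambda>w. a *s ?p w) = (\<lambda>w. a *s \<sigma> ?p w)" "\<sigma> (\<lambda>w. b *s ?q w) = (\<lambda>w. b *s \<sigma> ?q w)"
    using \<sigma> p q by (simp_all add: algebra_automorphism_def linear_bijection_def)
  ultimately have "\<sigma> As \<circ> \<sigma> ?p = (\<lambda>w. a *s \<sigma> ?p w + b *s \<sigma> ?q w)" by simp
  then have "(\<sigma> As \<circ> \<sigma> ?p) w = a *s \<sigma> ?p w + b *s \<sigma> ?q w" by simp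
  then show ?thesis using p q by simp
qed

end

lemma tau_cong: "i \<le> d \<Longrightarrow> (\<And>j. j \<le> d \<Longrightarrow> \<theta>' j = \<theta> j) \<Longrightarrow> tau \<theta>' i = tau \<theta> i"
  unfolding tau_def by (intro prod.cong) auto

lemma eta_cong: "(\<And>j. j \<le> d \<Longrightarrow> \<theta>' j = \<theta> j) \<Longrightarrow> eta d \<theta>' i = eta d \<theta> i"
  unfolding eta_def by (intro prod.cong) auto

section \<open>The action of \<open>T\<close> on the eigenvectors\<close>

theorem proposition15p2:
  fixes scale :: "'a::field \<Rightarrow> 'b::ab_group_add \<Rightarrow> 'b"
    and Basis :: "'b set" and d :: nat
    and A As T :: "'b \<Rightarrow> 'b" and E Es :: "nat \<Rightarrow> 'b \<Rightarrow> 'b"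
    and \<theta> \<theta>s varphi phi :: "nat \<Rightarrow> 'a"
    and dag :: "('b \<Rightarrow> 'b) \<Rightarrow> ('b \<Rightarrow> 'b)" and form :: "'b \<Rightarrow> 'b \<Rightarrow> 'a"
    and v0 vd v0s vds :: 'b and \<alpha> \<beta> \<alpha>s \<beta>s :: 'a
  assumes "finite_dimensional_vector_space scale Basis"
    and "vector_space.dim scale (UNIV :: 'b set) > 0"
    and "leonard_system scale d A E As Es"
    and "self_dual scale d A E As Es"
    and "parameter_array scale d A E As Es \<theta> \<theta>s varphi phi"
    and "algebra_antiautomorphism scale dag" and "dag A = A" and "dag As = As"
    and "associated_form scale dag form"
    and "T = (\<lambda>v. \<Sum>i\<le>d. poly_map scale (eta d \<theta> (d - i)) A
                 (Es 0 (E d (poly_map scale (tau \<theta>s i) As v))))"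
    and "v0 \<in> range (E 0)" and "v0 \<noteq> 0"
    and "vd \<in> range (E d)" and "vd \<noteq> 0"
    and "v0s \<in> range (Es 0)" and "v0s \<noteq> 0"
    and "vds \<in> range (Es d)" and "vds \<noteq> 0"
    and "\<alpha> = (\<Prod>i=1..d. varphi i) / poly (tau \<theta> d) (\<theta> d) * (form v0 v0s / form v0s v0s)"
    and "\<beta> = (\<Prod>i=1..d. varphi i) / poly (eta d \<theta> d) (\<theta> 0) * (form vd vds / form vds vds)"
    and "\<alpha>s = (\<Prod>i=1..d. varphi i) / poly (tau \<theta> d) (\<theta> d) * (form v0 v0s / form v0 v0)"
    and "\<beta>s = (\<Prod>i=1..d. varphi i) / poly (eta d \<theta> d) (\<theta> 0) * (form vd vds / form vd vd)"
  shows "\<forall>i\<le>d.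
      T (Es i v0) = scale \<alpha> (E i v0s) \<and>
      T (poly_map scale (tau \<theta>s i) As v0) = scale \<alpha> (poly_map scale (tau \<theta> i) A v0s) \<and>
      T (poly_map scale (eta d \<theta>s i) As v0) = scale \<alpha> (poly_map scale (eta d \<theta> i) A v0s) \<and>
      T (Es i vd) = scale \<beta> (E i vds) \<and>
      T (poly_map scale (tau \<theta>s i) As vd) = scale \<beta> (poly_map scale (tau \<theta> i) A vds) \<and>
      T (poly_map scale (eta d \<theta>s i) As vd) = scale \<beta> (poly_map scale (eta d \<theta> i) A vds) \<and>
      T (E i v0s) = scale \<alpha>s (Es i v0) \<and>
      T (poly_map scale (tau \<theta> i) A v0s) = scale \<alpha>s (poly_map scale (tau \<theta>s i) As v0) \<and>
      T (poly_map scale (eta d \<theta> i) A v0s) = scale \<alpha>s (poly_map scale (eta d \<theta>s i) As v0) \<and>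
      T (E i vds) = scale \<beta>s (Es i vd) \<and>
      T (poly_map scale (tau \<theta> i) A vds) = scale \<beta>s (poly_map scale (tau \<theta>s i) As vd) \<and>
      T (poly_map scale (eta d \<theta> i) A vds) = scale \<beta>s (poly_map scale (eta d \<theta>s i) As vd)"
proof -
  interpret finite_dimensional_vector_space scale Basis by fact
  have pair: "leonard_pair scale A As"
    and ord: "standard_ordering scale d A As E" "standard_ordering scale d As A Es"
    using assms(3) unfolding leonard_system_def by blast+
  have A_endo: "A \<in> endos scale" and As_endo: "As \<in> endos scale"
    using pair unfolding leonard_pair_def by blast+
  then have A_lin: "Vector_Spaces.linear scale scale A" and As_lin: "Vector_Spaces.linear scale scale As"
    by (auto simp: endos_def)
  have P: "primitive_idempotent_for scale A (\<theta> i) (E i)"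
    and Ps: "primitive_idempotent_for scale As (\<theta>s i) (Es i)" if "i \<le> d" for i
    using assms(5) that unfolding parameter_array_def by blast+
  obtain n u where "basis_seq scale n u" "diagonal_mat (matrix_of scale n u A)"
    using pair unfolding leonard_pair_def by blast
  from standard_ordering_eigenline_resolution[OF this A_lin ord(1) P]
  interpret A: eigenline_resolution scale d A E \<theta> by blast
  obtain n u where "basis_seq scale n u" "diagonal_mat (matrix_of scale n u As)"
    using pair unfolding leonard_pair_def by blast
  from standard_ordering_eigenline_resolution[OF this As_lin ord(2) Ps]
  interpret As: eigenline_resolution scale d As Es \<theta>s by blast
  obtain \<sigma> where \<sigma>: "algebra_automorphism scale \<sigma>" "\<sigma> A = As" "\<sigma> As = A"
    and \<sigma>_E: "\<And>i. i \<le> d \<Longrightarrow> \<sigma> (E i) = Es i" "\<And>i. i \<le> d \<Longrightarrow> \<sigma> (Es i) = E i"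
    using assms(4) unfolding self_dual_def by blast
  \<comment> \<open>The automorphism carries \<open>A E\<^sub>i = \<theta>\<^sub>i E\<^sub>i\<close> to \<open>As Es\<^sub>i = \<theta>\<^sub>i Es\<^sub>i\<close>.\<close>
  have \<theta>s: "\<theta>s i = \<theta> i" if i: "i \<le> d" for i
  proof -
    have "E i \<in> endos scale" using A.linear_E[OF i] by (simp add: endos_def)
    then have "As (Es i w) = scale (\<theta> i) (Es i w)" for w
      using automorphism_eigenrelation[OF \<sigma>(1,2) \<sigma>_E(1)[OF i] A_endo _ A.X_E[OF i]] by blast
    moreover obtain w where "Es i w \<noteq> 0"
      using standard_ordering_range_nontrivial[OF As_lin ord(2) i] by blast
    ultimately show ?thesis using As.X_E[OF i, of w] by simp
  qed
  have As_res: "eigenline_resolution scale d As Es \<theta>"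
    using standard_ordering_eigenline_resolution[of n u As d A Es \<theta>] Ps \<theta>s As_lin ord(2)
      \<open>basis_seq scale n u\<close> \<open>diagonal_mat (matrix_of scale n u As)\<close> by simp
  have tau_eq: "tau \<theta>s i = tau \<theta> i" and eta_eq: "eta d \<theta>s i = eta d \<theta> i" if "i \<le> d" for i
    by (rule tau_cong[OF that \<theta>s] eta_cong[OF \<theta>s]; assumption)+
  have Es0_endo: "Es 0 \<in> endos scale" using As.linear_E[of 0] by (simp add: endos_def)
  have v0s: "Es 0 v0s = v0s" and v0: "E 0 v0 = v0" and vd: "E d vd = vd" and vds: "Es d vds = vds"
    using assms(11,13,15,17) by auto
  have split: "split_sequence scale d A As (Es 0) \<theta>s (tau \<theta>) varphi"
    "split_sequence scale d A As (Es 0) \<theta>s (eta d \<theta>) phi"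
    using assms(5) unfolding parameter_array_def by blast+
  have split_relation: "As (poly_map scale (p i) A w)
      = scale (\<theta> i) (poly_map scale (p i) A w) + scale (c i) (poly_map scale (p (i - 1)) A w)"
    if "split_sequence scale d A As (Es 0) \<theta>s p c" "i \<in> {1..d}" "w \<in> range (Es 0)" "w \<noteq> 0"
    for p c i w
  proof -
    have "As (poly_map scale (p i) A w)
        = scale (\<theta>s i) (poly_map scale (p i) A w) + scale (c i) (poly_map scale (p (i - 1)) A w)"
      using that unfolding split_sequence_def by blast
    then show ?thesis using \<theta>s[of i] that(2) by simp
  qed
  interpret S: self_dual_split scale d A E As Es \<theta> v0s varphi phi
  proof (intro self_dual_split.intro self_dual_split_axioms.intro As_res A.eigenline_resolution_axioms)
    show "Es i (A (Es j x)) = 0" if "j \<le> d" "Es j x \<noteq> 0" "i \<le> d" "Suc j < i" for i j x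
      using standard_ordering_raises(1)[OF As_res ord(2) A_lin that(1,2)] that by blast
    show "Es (Suc j) (A (Es j x)) \<noteq> 0" if "j < d" "Es j x \<noteq> 0" for j x
      using standard_ordering_raises(2)[OF As_res ord(2) A_lin _ that(2)] that(1) by simp
    fix i assume i: "i \<in> {1..d}"
    show "As (poly_map scale (tau \<theta> i) A v0s)
      = scale (\<theta> i) (poly_map scale (tau \<theta> i) A v0s) + scale (varphi i) (poly_map scale (tau \<theta> (i - 1)) A v0s)"
      by (rule split_relation[OF split(1) i assms(15,16)])
    show "As (poly_map scale (eta d \<theta> i) A v0s)
      = scale (\<theta> i) (poly_map scale (eta d \<theta> i) A v0s) + scale (phi i) (poly_map scale (eta d \<theta> (i - 1)) A v0s)"
      by (rule split_relation[OF split(2) i assms(15,16)])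
    show "phi i \<noteq> 0"
      using split(2) i unfolding split_sequence_def by blast
    fix w assume "w \<in> range (E 0)"
    then have w: "E 0 w = w" by auto
    have "As (poly_map scale (eta d \<theta> i) A (Es 0 x))
      = scale (\<theta> i) (poly_map scale (eta d \<theta> i) A (Es 0 x))
      + scale (phi i) (poly_map scale (eta d \<theta> (i - 1)) A (Es 0 x))" for x
    \<comment> \<open>The split relations are given for nonzero vectors, but an identity of endomorphisms is needed.\<close>
    proof (cases "Es 0 x = 0")
      case True
      moreover have "As 0 = 0"
        using module_hom.zero[OF module_hom_linearI[OF As_lin]] .
      ultimately show ?thesis by (simp add: poly_map_at_0[OF A_lin])
    next
      case False
      then show ?thesis using split_relation[OF split(2) i] by blast
    qed
    from automorphism_split_relation[OF \<sigma>(1) A_endo As_endo Es0_endo this, of w]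
    show "A (poly_map scale (eta d \<theta> i) As w) = scale (\<theta> i) (poly_map scale (eta d \<theta> i) As w)
      + scale (phi i) (poly_map scale (eta d \<theta> (i - 1)) As w)"
      using \<sigma> \<sigma>_E(2)[of 0] w by simp
  qed (use v0s assms(16) in auto)
  have T: "T = S.T"
    unfolding assms(10) by (rule ext) (simp add: S.T_def tau_eq)
  have form: "bilinear_form scale form"
    using assms(9) by (simp add: associated_form_def)
  have sym: "form (A x) y = form x (A y)" "form (As x) y = form x (As y)" for x y
    using assms(7,8,9) A_endo As_endo by (simp_all add: associated_form_def)
  have nondeg: "\<forall>x. x \<noteq> 0 \<longrightarrow> (\<exists>y. form x y \<noteq> 0)"
    using associated_form_nondegenerate[OF assms(9)] by blast
  note projA = A.projection_by_form[OF form sym(1) nondeg]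
    and projAs = As.projection_by_form[OF form sym(2) nondeg]
  \<comment> \<open>The form turns the projections in the image formulas into the prescribed scalars.\<close>
  have v0s_image: "T v0s = scale \<alpha>s v0"
    using S.T_Es_0[OF v0s] projA(1)[OF _ assms(11,12), of v0s]
    by (simp add: T assms(21) S.K0_def)
  have v0_image: "T v0 = scale \<alpha> v0s"
    using S.T_E_0[OF v0] projAs(2)[OF _ assms(15,16), of v0]
    by (simp add: T assms(19) S.K0_def)
  have vds_image: "T vds = scale \<beta>s vd"
    using S.T_Es_d[OF vds] projA(1)[OF _ assms(13,14), of vds]
    by (simp add: T assms(22) S.Kd_def)
  have vd_image: "T vd = scale \<beta> vds"
    using S.T_E_d[OF vd] projAs(2)[OF _ assms(17,18), of vd]
    by (simp add: T assms(20) S.Kd_def)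
  have toA: "T (poly_map scale p As w) = poly_map scale p A (T w)"
    and toAs: "T (poly_map scale p A w) = poly_map scale p As (T w)" for p w
    unfolding T
    by (rule poly_map_intertwine[OF As_lin A_lin S.linear_T S.T_As]
        poly_map_intertwine[OF A_lin As_lin S.linear_T S.T_A])+
  have pull: "poly_map scale p A (scale c w) = scale c (poly_map scale p A w)"
    "poly_map scale p As (scale c w) = scale c (poly_map scale p As w)" for p c w
    using linear_poly_map[OF A_lin] linear_poly_map[OF As_lin]
    by (simp_all add: Vector_Spaces.linear_iff)
  show ?thesis
    by (intro allI impI)
      (simp only: tau_eq eta_eq toA toAs S.T_E[folded T] S.T_Es[folded T]
        v0_image v0s_image vd_image vds_image pull A.E_scale As.E_scale simp_thms)
qed

end
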